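(* The center of $\mathcal{D}$ is the commutative subalgebra generated by $z$, $\omega$ and $\theta$, and it is isomorphic to the quotient $\Bbbk[X,Y,Z]/(XZ-Y^2)$.
   Context: $\Bbbk$ is an algebraically closed field of characteristic $0$. The algebra $\mathcal{D}$ (the double of the Jordan plane) is the associative unital $\Bbbk$-algebra with generators $u, v, \zeta, g^{\pm1}, x, y$ and relations $g^{\pm1}g^{\mp1}=1$, $\zeta g=g\zeta$, $gx=xg$, $gy=yg+xg$, $\zeta y=y\zeta+y$, $\zeta x=x\zeta+x$, $ug=gu$, $vg=gv+gu$, $v\zeta=\zeta v+v$, $u\zeta=\zeta u+u$, $yx=xy-\frac12x^2$, $vu=uv-\frac12u^2$, $ux=xu$, $vx=xv+(1-g)+xu$, $uy=yu+(1-g)$, $vy=yv-g\zeta+yu$. It is a noetherian domain with PBW basis $\{x^ny^rg^m\zeta^ku^iv^j: i,j,k,n,r\in\mathbb{N}_0,\ m\in\mathbb{Z}\}$. In $\mathcal{D}$ set $q:=ux+2(1+g)$, $\; z:=q^2g^{-1}$, $\; s:=xv+uy+(-\frac12ux+g-1)\zeta-2(1+g)$, $\;\theta:=s^2g^{-1}$, $\;\omega:=qg^{-1}s$. (Equivalently $\omega=zz'$ with $z'=q^{-1}s$ in the localization of $\mathcal{D}$ at the powers of the normal element $q$.) *)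

theory Defs
  imports
    "HOL.Hull"
    "HOL-Library.Poly_Mapping"
    "HOL-Computational_Algebra.Polynomial"
begin

section \<open>Two-sided ideals, centers, subalgebras and isomorphisms\<close>

definition two_sided_ideal :: "'a::ring_1 set \<Rightarrow> bool" where
  "two_sided_ideal I \<longleftrightarrow>
     0 \<in> I \<and> (\<forall>a\<in>I. \<forall>b\<in>I. a + b \<in> I) \<and> (\<forall>a\<in>I. \<forall>r. r * a \<in> I \<and> a * r \<in> I)"

definition center :: "'a::ring_1 set" where
  "center = {c. \<forall>a. c * a = a * c}"

text \<open>
  An algebra over \<open>'k\<close> is a type of class \<open>ring_1\<close> together with an explicit scalar
  multiplication, since \<open>'k\<close> cannot be a parameter of a type class.
  Subalgebras are unital; the subalgebra generated by \<open>S\<close> is \<open>subalgebra scale hull S\<close>.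
\<close>

definition subalgebra :: "('k::field \<Rightarrow> 'a::ring_1 \<Rightarrow> 'a) \<Rightarrow> 'a set \<Rightarrow> bool" where
  "subalgebra scale B \<longleftrightarrow>
     1 \<in> B \<and> (\<forall>a\<in>B. \<forall>b\<in>B. a + b \<in> B \<and> a * b \<in> B) \<and> (\<forall>c. \<forall>a\<in>B. scale c a \<in> B)"

definition algebra_iso ::
    "('k::field \<Rightarrow> 'a::ring_1 \<Rightarrow> 'a) \<Rightarrow> 'a set \<Rightarrow> ('k \<Rightarrow> 'b::ring_1 \<Rightarrow> 'b) \<Rightarrow> 'b set
      \<Rightarrow> ('a \<Rightarrow> 'b) \<Rightarrow> bool" where
  "algebra_iso scaleA A scaleB B f \<longleftrightarrow>
     bij_betw f A B \<and> f 1 = 1 \<and>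
     (\<forall>a\<in>A. \<forall>b\<in>A. f (a + b) = f a + f b \<and> f (a * b) = f a * f b) \<and>
     (\<forall>c. \<forall>a\<in>A. f (scaleA c a) = scaleB c (f a))"

lemma two_sided_ideal_hull: "two_sided_ideal (two_sided_ideal hull S)"
  by (rule hull_in) (auto simp: two_sided_ideal_def)

definition ideal_cong :: "'a::ring_1 set \<Rightarrow> 'a \<Rightarrow> 'a \<Rightarrow> bool" where
  "ideal_cong S a b \<longleftrightarrow> a - b \<in> two_sided_ideal hull S"

lemma ideal_cong_refl: "ideal_cong S a a"
  using two_sided_ideal_hull[of S] by (simp add: ideal_cong_def two_sided_ideal_def)

lemma ideal_cong_sym: assumes "ideal_cong S a b" shows "ideal_cong S b a"
proof -
  have "(- 1) * (a - b) \<in> two_sided_ideal hull S"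
    using assms two_sided_ideal_hull[of S] unfolding ideal_cong_def two_sided_ideal_def by blast
  then show ?thesis by (simp add: ideal_cong_def)
qed

lemma ideal_cong_add:
  assumes "ideal_cong S a b" "ideal_cong S c d" shows "ideal_cong S (a + c) (b + d)"
proof -
  have "(a - b) + (c - d) \<in> two_sided_ideal hull S"
    using assms two_sided_ideal_hull[of S] unfolding ideal_cong_def two_sided_ideal_def by blast
  then show ?thesis by (simp add: ideal_cong_def algebra_simps)
qed

lemma ideal_cong_trans:
  assumes "ideal_cong S a b" "ideal_cong S b c" shows "ideal_cong S a c"
proof -
  have "(a - b) + (b - c) \<in> two_sided_ideal hull S"
    using assms two_sided_ideal_hull[of S] unfolding ideal_cong_def two_sided_ideal_def by blast
  then show ?thesis by (simp add: ideal_cong_def)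
qed

lemma ideal_cong_mult:
  assumes "ideal_cong S a b" "ideal_cong S c d" shows "ideal_cong S (a * c) (b * d)"
proof -
  have "(a - b) * c + b * (c - d) \<in> two_sided_ideal hull S"
    using assms two_sided_ideal_hull[of S] unfolding ideal_cong_def two_sided_ideal_def by blast
  then show ?thesis by (simp add: ideal_cong_def algebra_simps)
qed

lemma ideal_cong_uminus: "ideal_cong S a b \<Longrightarrow> ideal_cong S (- a) (- b)"
  using ideal_cong_mult[OF ideal_cong_refl[of S "- 1"]] by fastforce

lemma ideal_cong_diff:
  "ideal_cong S a b \<Longrightarrow> ideal_cong S c d \<Longrightarrow> ideal_cong S (a - c) (b - d)"
  using ideal_cong_add[of S a b "- c" "- d"] by (simp add: ideal_cong_uminus)

lemma equivp_ideal_cong: "equivp (ideal_cong S)"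
  by (intro equivpI reflpI sympI transpI)
    (blast intro: ideal_cong_refl ideal_cong_sym ideal_cong_trans)+


section \<open>Monoid algebras\<close>

text \<open>
  \<open>'m \<Rightarrow>\<^sub>0 'k\<close> is the monoid algebra over \<open>'k\<close> of the (additively written, possibly
  noncommutative) monoid \<open>'m\<close>.
\<close>

definition scalar :: "'k::field \<Rightarrow> 'm::monoid_add \<Rightarrow>\<^sub>0 'k" where
  "scalar c = Poly_Mapping.single 0 c"

text \<open>The extension of a multiplicative character of the monoid, used only to see that the
  quotients below are nonzero.\<close>

definition char_ext :: "('m::monoid_add \<Rightarrow> 'k::field) \<Rightarrow> ('m \<Rightarrow>\<^sub>0 'k) \<Rightarrow> 'k" where
  "char_ext \<chi> p = (\<Sum>m\<in>Poly_Mapping.keys p. Poly_Mapping.lookup p m * \<chi> m)"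

lemma char_ext_single [simp]: "char_ext \<chi> (Poly_Mapping.single m c) = c * \<chi> m"
  by (simp add: char_ext_def)

lemma char_ext_superset:
  assumes "finite A" "Poly_Mapping.keys p \<subseteq> A"
  shows "char_ext \<chi> p = (\<Sum>m\<in>A. Poly_Mapping.lookup p m * \<chi> m)"
  unfolding char_ext_def using assms
  by (intro sum.mono_neutral_left) (auto simp: in_keys_iff)

lemma char_ext_zero [simp]: "char_ext \<chi> 0 = 0"
  by (simp add: char_ext_def)

lemma char_ext_add [simp]: "char_ext \<chi> (p + q) = char_ext \<chi> p + char_ext \<chi> q"
proof -
  let ?A = "Poly_Mapping.keys p \<union> Poly_Mapping.keys q"
  have "Poly_Mapping.keys (p + q) \<subseteq> ?A" by (rule keys_add)
  then show ?thesis
    by (simp add: char_ext_superset[of ?A] lookup_add distrib_right sum.distrib)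
qed

lemma char_ext_diff [simp]: "char_ext \<chi> (p - q) = char_ext \<chi> p - char_ext \<chi> q"
  using char_ext_add[of \<chi> "p - q" q] by simp

lemma char_ext_sum: "char_ext \<chi> (sum f A) = (\<Sum>a\<in>A. char_ext \<chi> (f a))"
  by (induction A rule: infinite_finite_induct) auto

lemma char_ext_mult:
  assumes "\<And>m n. \<chi> (m + n) = \<chi> m * \<chi> n"
  shows "char_ext \<chi> (p * q) = char_ext \<chi> p * char_ext \<chi> q"
proof -
  have decomp: "r = (\<Sum>m\<in>Poly_Mapping.keys r. Poly_Mapping.single m (Poly_Mapping.lookup r m))"
    for r :: "'a \<Rightarrow>\<^sub>0 'b"
    by (rule poly_mapping_eqI)
      (auto simp: lookup_sum lookup_single when_def in_keys_iff)
  have "p * q = (\<Sum>m\<in>Poly_Mapping.keys p. \<Sum>n\<in>Poly_Mapping.keys q.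
      Poly_Mapping.single (m + n) (Poly_Mapping.lookup p m * Poly_Mapping.lookup q n))"
    by (subst decomp[of p], subst decomp[of q]) (simp add: sum_product mult_single)
  then show ?thesis
    by (simp add: char_ext_sum char_ext_def[of _ p] char_ext_def[of _ q] sum_product assms
        mult_ac)
qed

lemma not_ideal_cong_0_1:
  assumes mult: "\<And>m n. \<chi> (m + n) = \<chi> m * \<chi> n" and one: "\<chi> 0 = 1"
    and S: "\<And>p. p \<in> S \<Longrightarrow> char_ext \<chi> p = 0"
  shows "\<not> ideal_cong S 0 1"
proof
  assume "ideal_cong S 0 1"
  moreover have "two_sided_ideal {p. char_ext \<chi> p = 0}"
    by (auto simp: two_sided_ideal_def char_ext_mult[OF mult])
  then have "two_sided_ideal hull S \<subseteq> {p. char_ext \<chi> p = 0}"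
    using S by (intro hull_minimal) auto
  ultimately have "char_ext \<chi> (0 - 1) = 0"
    unfolding ideal_cong_def by blast
  then show False
    using one by (simp only: char_ext_diff) (simp flip: single_one)
qed


section \<open>The free algebra\<close>

datatype 'a free_monoid = Word "'a list"

instantiation free_monoid :: (type) monoid_add
begin

definition zero_free_monoid :: "'a free_monoid" where
  "0 = Word []"

fun plus_free_monoid :: "'a free_monoid \<Rightarrow> 'a free_monoid \<Rightarrow> 'a free_monoid" where
  "Word v + Word w = Word (v @ w)"

instance
proof
  fix a b c :: "'a free_monoid"
  show "a + b + c = a + (b + c)" by (cases a; cases b; cases c) simp
  show "0 + a = a" "a + 0 = a" by (cases a; simp add: zero_free_monoid_def)+
qed

end

type_synonym ('a, 'k) free_algebra = "'a free_monoid \<Rightarrow>\<^sub>0 'k"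

definition free_gen :: "'a \<Rightarrow> ('a, 'k::field) free_algebra" where
  "free_gen a = Poly_Mapping.single (Word [a]) 1"


section \<open>The double of the Jordan plane\<close>

datatype double_gen = Gen_u | Gen_v | Gen_zeta | Gen_g | Gen_ginv | Gen_x | Gen_y

text \<open>The relation \<open>a = b\<close> is encoded as the element \<open>a - b\<close> of the free algebra.\<close>

definition double_rels :: "(double_gen, 'k::field) free_algebra set" where
  "double_rels =
    (let u = free_gen Gen_u; v = free_gen Gen_v; \<zeta> = free_gen Gen_zeta;
         g = free_gen Gen_g; g' = free_gen Gen_ginv;
         x = free_gen Gen_x; y = free_gen Gen_y
     in
      {g * g' - 1,
       g' * g - 1,
       \<zeta> * g - g * \<zeta>,
       g * x - x * g,
       g * y - (y * g + x * g),
       \<zeta> * y - (y * \<zeta> + y),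
       \<zeta> * x - (x * \<zeta> + x),
       u * g - g * u,
       v * g - (g * v + g * u),
       v * \<zeta> - (\<zeta> * v + v),
       u * \<zeta> - (\<zeta> * u + u),
       y * x - (x * y - scalar (1/2) * x^2),
       v * u - (u * v - scalar (1/2) * u^2),
       u * x - x * u,
       v * x - (x * v + (1 - g) + x * u),
       u * y - (y * u + (1 - g)),
       v * y - (y * v - g * \<zeta> + y * u)})"

quotient_type (overloaded) 'k double_jordan =
  "(double_gen, 'k::field) free_algebra" / "ideal_cong double_rels"
  by (rule equivp_ideal_cong)

fun group_like_word :: "double_gen free_monoid \<Rightarrow> bool" where
  "group_like_word (Word w) \<longleftrightarrow> set w \<subseteq> {Gen_g, Gen_ginv}"

lemma double_rels_nontrivial: "\<not> ideal_cong (double_rels :: (_, 'k::field) free_algebra set) 0 1"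
proof (rule not_ideal_cong_0_1)
  let ?\<chi> = "\<lambda>w. if group_like_word w then 1 else 0 :: 'k"
  show mult: "?\<chi> (m + n) = ?\<chi> m * ?\<chi> n" for m n
    by (cases m; cases n) auto
  show one: "?\<chi> 0 = 1" by (simp add: zero_free_monoid_def)
  have c1: "char_ext ?\<chi> 1 = 1" using one by (simp flip: single_one)
  show "char_ext ?\<chi> p = 0" if "p \<in> double_rels" for p
    using that
    by (auto simp: double_rels_def Let_def free_gen_def scalar_def power2_eq_square
        char_ext_mult[OF mult] c1)
qed

instantiation double_jordan :: (field) ring_1
begin

lift_definition zero_double_jordan :: "'a double_jordan" is 0 .
lift_definition one_double_jordan :: "'a double_jordan" is 1 .
lift_definition plus_double_jordan :: "'a double_jordan \<Rightarrow> 'a double_jordan \<Rightarrow> 'a double_jordan"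
  is "(+)" by (rule ideal_cong_add)
lift_definition minus_double_jordan :: "'a double_jordan \<Rightarrow> 'a double_jordan \<Rightarrow> 'a double_jordan"
  is "(-)" by (rule ideal_cong_diff)
lift_definition uminus_double_jordan :: "'a double_jordan \<Rightarrow> 'a double_jordan"
  is uminus by (rule ideal_cong_uminus)
lift_definition times_double_jordan :: "'a double_jordan \<Rightarrow> 'a double_jordan \<Rightarrow> 'a double_jordan"
  is "(*)" by (rule ideal_cong_mult)

instance
proof
  show "(0 :: 'a double_jordan) \<noteq> 1"
    by transfer (rule double_rels_nontrivial)
qed (transfer; simp add: algebra_simps ideal_cong_refl; fail)+

end

lift_definition scale_D :: "'k::field \<Rightarrow> 'k double_jordan \<Rightarrow> 'k double_jordan"
  is "\<lambda>c p. scalar c * p" by (rule ideal_cong_mult[OF ideal_cong_refl])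

lift_definition gen_D :: "double_gen \<Rightarrow> 'k::field double_jordan" is free_gen .

definition q_D :: "'k::field double_jordan" where
  "q_D = (let u = gen_D Gen_u; x = gen_D Gen_x; g = gen_D Gen_g in
     u * x + scale_D 2 (1 + g))"

definition s_D :: "'k::field double_jordan" where
  "s_D =
    (let u = gen_D Gen_u; v = gen_D Gen_v; \<zeta> = gen_D Gen_zeta; g = gen_D Gen_g;
         x = gen_D Gen_x; y = gen_D Gen_y
     in x * v + u * y + (- scale_D (1/2) (u * x) + g - 1) * \<zeta> - scale_D 2 (1 + g))"

definition z_D :: "'k::field double_jordan" where
  "z_D = q_D^2 * gen_D Gen_ginv"

definition theta_D :: "'k::field double_jordan" where
  "theta_D = s_D^2 * gen_D Gen_ginv"

definition omega_D :: "'k::field double_jordan" where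
  "omega_D = q_D * gen_D Gen_ginv * s_D"


section \<open>The quotient of the polynomial ring in X, Y, Z by (XZ - Y^2)\<close>

datatype cone_var = Var_X | Var_Y | Var_Z

text \<open>Monomials are exponent vectors \<open>cone_var \<Rightarrow>\<^sub>0 nat\<close>.\<close>

type_synonym 'k cone_poly = "(cone_var \<Rightarrow>\<^sub>0 nat) \<Rightarrow>\<^sub>0 'k"

definition poly_var :: "cone_var \<Rightarrow> 'k::field cone_poly" where
  "poly_var i = Poly_Mapping.single (Poly_Mapping.single i 1) 1"

definition cone_rels :: "'k::field cone_poly set" where
  "cone_rels = {poly_var Var_X * poly_var Var_Z - poly_var Var_Y ^ 2}"

quotient_type (overloaded) 'k cone_ring = "'k::field cone_poly" / "ideal_cong cone_rels"
  by (rule equivp_ideal_cong)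

lemma cone_rels_nontrivial: "\<not> ideal_cong (cone_rels :: 'k::field cone_poly set) 0 1"
  by (rule not_ideal_cong_0_1[where \<chi> = "\<lambda>_. 1"])
    (auto simp: cone_rels_def poly_var_def power2_eq_square char_ext_mult)

instantiation cone_ring :: (field) comm_ring_1
begin

lift_definition zero_cone_ring :: "'a cone_ring" is 0 .
lift_definition one_cone_ring :: "'a cone_ring" is 1 .
lift_definition plus_cone_ring :: "'a cone_ring \<Rightarrow> 'a cone_ring \<Rightarrow> 'a cone_ring"
  is "(+)" by (rule ideal_cong_add)
lift_definition minus_cone_ring :: "'a cone_ring \<Rightarrow> 'a cone_ring \<Rightarrow> 'a cone_ring"
  is "(-)" by (rule ideal_cong_diff)
lift_definition uminus_cone_ring :: "'a cone_ring \<Rightarrow> 'a cone_ring"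
  is uminus by (rule ideal_cong_uminus)
lift_definition times_cone_ring :: "'a cone_ring \<Rightarrow> 'a cone_ring \<Rightarrow> 'a cone_ring"
  is "(*)" by (rule ideal_cong_mult)

instance
proof
  show "(0 :: 'a cone_ring) \<noteq> 1"
    by transfer (rule cone_rels_nontrivial)
qed (transfer; simp add: algebra_simps ideal_cong_refl; fail)+

end

lift_definition scale_cone :: "'k::field \<Rightarrow> 'k cone_ring \<Rightarrow> 'k cone_ring"
  is "\<lambda>c p. scalar c * p" by (rule ideal_cong_mult[OF ideal_cong_refl])

end

theory Submission
  imports Defs "HOL-Library.Product_Plus"
begin

text \<open>
  Adjoin a square root \<open>h\<close> of \<open>g\<close>. Then \<open>a
      = q h\<^sup>-\<^sup>1\<close> and \<open>b = s h\<^sup>-\<^sup>1\<close> become central; solving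
  \<open>q = a h\<close> and \<open>s
      = b h\<close> for \<open>u\<close> and \<open>v\<close> embeds the algebra into the differential operators on
  the torus with coordinates \<open>x\<close>, \<open>h\<close> and with parameters \<open>a\<close>, \<open>b\<close>, where \<open>\<zeta>\<close> and \<open>x\<^sup>-\<^sup>1 y\<close> act by
  Euler operators. The embedding is faithful because the algebra is an iterated Ore extension and
  at each step the top coefficient of a relation can be isolated by commutators with a suitable
  operator. A central element commutes with \<open>x\<close>, \<open>h\<close> and both Euler operators, hence acts by
  multiplication with some polynomial in \<open>a\<close>, \<open>b\<close>, which is even since only \<open>a h\<close>, \<open>b h\<close>
  and \<open>h\<^sup>2\<close> occur. The even polynomials are generated by \<open>a\<^sup>2
      = z\<close>, \<open>a b = \<omega>\<close> and \<open>b\<^sup>2 = \<theta>\<close>,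
  subject only to \<open>z \<theta> = \<omega>\<^sup>2\<close>.
\<close>

section \<open>Algebras over a field\<close>

lemma subalgebraI:
  assumes "1 \<in> B" "\<And>a b. a \<in> B \<Longrightarrow> b \<in> B \<Longrightarrow> a + b \<in> B"
    "\<And>a b. a \<in> B \<Longrightarrow> b \<in> B \<Longrightarrow> a * b \<in> B" "\<And>c a. a \<in> B \<Longrightarrow> scale c a \<in> B"
  shows "subalgebra scale B"
  using assms unfolding subalgebra_def by blast

lemma ideal_cong_rel: "a - b \<in> S \<Longrightarrow> ideal_cong S a b"
  by (simp add: ideal_cong_def hull_inc)

text \<open>The scalar action is a locale parameter, so the same facts serve monoid algebras, rings
  of operators, the double and the cone ring.\<close>

locale unital_algebra =
  fixes scale :: "'k::field \<Rightarrow> 'a::ring_1 \<Rightarrow> 'a"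
  assumes scale_add_left: "scale (c + d) a = scale c a + scale d a"
    and scale_add_right: "scale c (a + b) = scale c a + scale c b"
    and scale_scale: "scale c (scale d a) = scale (c * d) a"
    and scale_one: "scale 1 a = a"
    and mult_scale_left: "scale c a * b = scale c (a * b)"
    and mult_scale_right: "a * scale c b = scale c (a * b)"
begin

lemma scale_zero_left [simp]: "scale 0 a = 0"
  using scale_add_left[of 0 0 a] by simp

lemma scale_zero_right [simp]: "scale c 0 = 0"
  using scale_add_right[of c 0 0] by simp

lemma scale_minus_left: "scale (- c) a = - scale c a"
  using scale_add_left[of c "- c" a] by (simp add: minus_unique)

lemma scale_eq_0_iff [simp]: "scale c a = 0 \<longleftrightarrow> c = 0 \<or> a = 0"
proof
  assume "scale c a = 0"
  then have "scale (inverse c) (scale c a) = 0" by simp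
  then show "c = 0 \<or> a = 0"
    by (cases "c = 0") (auto simp: scale_scale scale_one)
qed auto

lemma scale_of_nat: "scale (of_nat n) a = of_nat n * a"
  by (induction n) (auto simp: scale_add_left scale_one algebra_simps)

lemma scale_sum: "scale c (sum f A) = (\<Sum>i\<in>A. scale c (f i))"
  by (induction A rule: infinite_finite_induct) (auto simp: scale_add_right)

section \<open>Generated subalgebras\<close>

abbreviation gen :: "'a set \<Rightarrow> 'a set" where
  "gen \<equiv> (hull) (subalgebra scale)"

lemma subalgebra_gen: "subalgebra scale (gen S)"
  by (rule hull_in) (auto simp: subalgebra_def)

lemma gen_base: "a \<in> S \<Longrightarrow> a \<in> gen S"
  by (rule hull_inc)

lemma gen_one: "1 \<in> gen S"
  and gen_add: "a \<in> gen S \<Longrightarrow> b \<in> gen S \<Longrightarrow> a + b \<in> gen S"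
  and gen_mult: "a \<in> gen S \<Longrightarrow> b \<in> gen S \<Longrightarrow> a * b \<in> gen S"
  and gen_scale: "a \<in> gen S \<Longrightarrow> scale c a \<in> gen S"
  using subalgebra_gen[of S] by (auto simp: subalgebra_def)

lemma gen_zero: "0 \<in> gen S"
  using gen_scale[OF gen_one, where c = 0] by simp

lemma gen_uminus: "a \<in> gen S \<Longrightarrow> - a \<in> gen S"
  using gen_scale[where c = "- 1"] by (simp add: scale_minus_left scale_one)

lemma gen_diff: "a \<in> gen S \<Longrightarrow> b \<in> gen S \<Longrightarrow> a - b \<in> gen S"
  using gen_add[of a _ "- b"] by (simp add: gen_uminus)

lemma gen_power: "a \<in> gen S \<Longrightarrow> a ^ n \<in> gen S"
  by (induction n) (auto intro: gen_one gen_mult)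

lemma gen_sum: "(\<And>i. i \<in> A \<Longrightarrow> f i \<in> gen S) \<Longrightarrow> sum f A \<in> gen S"
  by (induction A rule: infinite_finite_induct) (auto intro: gen_zero gen_add)

lemmas gen_intros = gen_one gen_zero gen_add gen_mult gen_scale gen_uminus gen_diff gen_power

lemma gen_minimal: "S \<subseteq> B \<Longrightarrow> subalgebra scale B \<Longrightarrow> gen S \<subseteq> B"
  by (rule hull_minimal)

lemma gen_empty: assumes "a \<in> gen {}" obtains c where "a = scale c 1"
proof -
  have "gen {} \<subseteq> range (\<lambda>c. scale c 1)"
    by (rule gen_minimal)
      (auto simp: subalgebra_def mult_scale_left scale_scale intro: range_eqI
        simp flip: scale_add_left, metis scale_one rangeI)
  then show ?thesis using assms that by blast
qed

lemma gen_commute: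
  assumes "a \<in> gen S" "\<And>s. s \<in> S \<Longrightarrow> s * b = b * s"
  shows "a * b = b * a"
proof -
  have "gen S \<subseteq> {a. a * b = b * a}"
    using assms(2)
    by (intro gen_minimal)
      (auto simp: subalgebra_def algebra_simps mult_scale_left mult_scale_right,
        metis mult.assoc)
  then show ?thesis using assms(1) by blast
qed

section \<open>Left polynomials in one element over a subalgebra\<close>

text \<open>Coefficients vanish from \<open>N\<close> on, so that two expressions can be padded to a
  common length before they are added.\<close>

definition left_polys :: "'a set \<Rightarrow> 'a \<Rightarrow> 'a set" where
  "left_polys L t =
    {r. \<exists>a N. (\<forall>k. a k \<in> L) \<and> (\<forall>k\<ge>N. a k = 0) \<and> r
        = (\<Sum>k<N. a k * t ^ k)}"

lemma left_polys_term:
  assumes "a \<in> gen S" shows "a * t ^ k \<in> left_polys (gen S) t"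
  unfolding left_polys_def using assms
  by (auto intro!: exI[of _ "\<lambda>i. if i = k then a else 0"] exI[of _ "Suc k"]
      simp: gen_zero if_distrib[of "\<lambda>c. c * _"] cong: if_cong)

lemma left_polys_add:
  assumes "r \<in> left_polys (gen S) t" "r' \<in> left_polys (gen S) t"
  shows "r + r' \<in> left_polys (gen S) t"
proof -
  obtain a N where a: "\<And>k. a k \<in> gen S" "\<And>k. k \<ge> N \<Longrightarrow> a k
      = 0" "r = (\<Sum>k<N. a k * t ^ k)"
    using assms(1) unfolding left_polys_def by blast
  obtain b M where b: "\<And>k. b k \<in> gen S" "\<And>k. k \<ge> M \<Longrightarrow> b k
      = 0" "r' = (\<Sum>k<M. b k * t ^ k)"
    using assms(2) unfolding left_polys_def by blast
  have "r = (\<Sum>k<max N M. a k * t ^ k)" "r' = (\<Sum>k<max N M. b k * t ^ k)"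
    unfolding a(3) b(3) by (rule sum.mono_neutral_left; auto simp: a(2) b(2))+
  then have "r + r' = (\<Sum>k<max N M. (a k + b k) * t ^ k)"
    by (simp add: distrib_right sum.distrib)
  then show ?thesis
    unfolding left_polys_def using a b
    by (intro CollectI exI[of _ "\<lambda>k. a k + b k"] exI[of _ "max N M"]) (auto intro: gen_add)
qed

lemma left_polys_sum:
  "(\<And>i. i \<in> A \<Longrightarrow> f i \<in> left_polys (gen S) t) \<Longrightarrow> sum f A \<in> left_polys (gen S) t"
proof (induction A rule: infinite_finite_induct)
  case empty
  show ?case using left_polys_term[OF gen_zero, where k = 0] by simp
next
  case (infinite A)
  then show ?case using left_polys_term[OF gen_zero, where k = 0] by simp
qed (auto intro: left_polys_add)

text \<open>The spanning half of the theorem on Ore extensions.\<close>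

lemma gen_insert_left_polys:
  assumes rel: "\<And>s. s \<in> S \<Longrightarrow> \<exists>\<alpha>\<in>gen S. \<exists>\<beta>\<in>gen S. t * s = \<alpha> * t + \<beta>"
  shows "gen (insert t S) \<subseteq> left_polys (gen S) t"
proof -
  \<comment> \<open>\<open>?Q\<close> collects the elements across which \<open>t\<close> can be
    moved. It is closed under the algebra operations, so the hypothesis on \<open>S\<close> extends
    to all of \<open>gen S\<close>.\<close>
  let ?O = "left_polys (gen S) t" and ?Q
      = "{s \<in> gen S. \<exists>\<alpha>\<in>gen S. \<exists>\<beta>\<in>gen S. t * s = \<alpha> * t + \<beta>}"
  have QI: "a \<in> ?Q"
      if "t * a = \<alpha> * t + \<beta>" "a \<in> gen S" "\<alpha> \<in> gen S" "\<beta> \<in> gen S" for a \<alpha> \<beta>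
    using that by blast
  have mult: "a * b \<in> ?Q" if ab: "a \<in> ?Q" "b \<in> ?Q" for a b
  proof -
    obtain \<alpha> \<beta> where 1: "\<alpha> \<in> gen S" "\<beta> \<in> gen S" "t * a
        = \<alpha> * t + \<beta>" using ab by blast
    obtain \<gamma> \<delta> where 2: "\<gamma> \<in> gen S" "\<delta> \<in> gen S" "t * b
        = \<gamma> * t + \<delta>" using ab by blast
    have "t * (a * b) = (t * a) * b" by (simp add: mult.assoc)
    also have "\<dots> = \<alpha> * (t * b) + \<beta> * b" by (simp add: 1 algebra_simps)
    also have "\<dots> = \<alpha> * \<gamma> * t + (\<alpha> * \<delta> + \<beta> * b)"
      by (simp add: 2 algebra_simps)
    finally show ?thesis
      by (rule QI) (use 1 2 ab in \<open>auto intro!: gen_intros\<close>)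
  qed
  have add: "a + b \<in> ?Q" if ab: "a \<in> ?Q" "b \<in> ?Q" for a b
  proof -
    obtain \<alpha> \<beta> where 1: "\<alpha> \<in> gen S" "\<beta> \<in> gen S" "t * a
        = \<alpha> * t + \<beta>" using ab by blast
    obtain \<gamma> \<delta> where 2: "\<gamma> \<in> gen S" "\<delta> \<in> gen S" "t * b
        = \<gamma> * t + \<delta>" using ab by blast
    have "t * (a + b) = (\<alpha> + \<gamma>) * t + (\<beta> + \<delta>)"
      by (simp add: 1 2 algebra_simps)
    then show ?thesis by (rule QI) (use 1 2 ab in \<open>auto intro!: gen_intros\<close>)
  qed
  have scl: "scale c a \<in> ?Q" if ab: "a \<in> ?Q" for a c
  proof -
    obtain \<alpha> \<beta> where 1: "\<alpha> \<in> gen S" "\<beta> \<in> gen S" "t * a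
        = \<alpha> * t + \<beta>" using ab by blast
    have "t * scale c a = scale c \<alpha> * t + scale c \<beta>"
      by (simp add: 1 mult_scale_left mult_scale_right scale_add_right)
    then show ?thesis by (rule QI) (use 1 ab in \<open>auto intro!: gen_intros\<close>)
  qed
  have "1 \<in> ?Q" by (rule QI[of _ 1 0]) (auto intro!: gen_intros)
  then have "subalgebra scale ?Q" using mult add scl by (simp only: subalgebra_def) blast
  then have "gen S \<subseteq> ?Q"
    using rel by (intro gen_minimal) (auto intro: gen_base)
  then have tL: "\<exists>\<alpha>\<in>gen S. \<exists>\<beta>\<in>gen S. t * a
      = \<alpha> * t + \<beta>" if "a \<in> gen S" for a
    using that by blast
  \<comment> \<open>\<open>?O\<close> is not visibly closed under products. It suffices that left
    multiplication by \<open>t\<close> and by \<open>S\<close> preserves it: then the whole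
    generated algebra preserves it, and \<open>?O\<close> contains 1.\<close>
  have left: "s * r \<in> ?O" if s: "s \<in> insert t S" and r: "r \<in> ?O" for s r
  proof -
    obtain a N where a: "\<And>k. a k \<in> gen S" "r = (\<Sum>k<N. a k * t ^ k)"
      using r unfolding left_polys_def by blast
    have "s * (a k * t ^ k) \<in> ?O" for k
    proof (cases "s = t")
      case True
      obtain \<alpha> \<beta> where 1: "\<alpha> \<in> gen S" "\<beta> \<in> gen S" "t * a k
          = \<alpha> * t + \<beta>" using tL[OF a(1)] by blast
      have "s * (a k * t ^ k) = (t * a k) * t ^ k" by (simp add: True mult.assoc)
      also have "\<dots> = \<alpha> * t ^ Suc k + \<beta> * t ^ k" by (simp add: 1 algebra_simps)
      finally show ?thesis using left_polys_term[OF 1(1)] left_polys_term[OF 1(2)]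
        by (simp only: left_polys_add)
    next
      case False
      then have "s * a k \<in> gen S" using s a(1) by (auto intro: gen_mult gen_base)
      then show ?thesis using left_polys_term by (simp flip: mult.assoc)
    qed
    then show ?thesis by (simp add: a(2) sum_distrib_left left_polys_sum)
  qed
  have "subalgebra scale {s. \<forall>r\<in>?O. s * r \<in> ?O}"
  proof -
    have "scale c r \<in> ?O" if r: "r \<in> ?O" for c r
    proof -
      obtain a N where a: "\<And>k. a k \<in> gen S" "r = (\<Sum>k<N. a k * t ^ k)"
        using r unfolding left_polys_def by blast
      show ?thesis
        by (auto simp: a(2) scale_sum intro!: left_polys_sum simp flip: mult_scale_left)
          (intro left_polys_term gen_scale a(1))
    qed
    then show ?thesis
      by (auto simp: subalgebra_def distrib_right mult_scale_left mult.assoc intro: left_polys_add)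
  qed
  then have "gen (insert t S) \<subseteq> {s. \<forall>r\<in>?O. s * r \<in> ?O}"
    using left by (intro gen_minimal) auto
  moreover have "1 \<in> ?O" using left_polys_term[OF gen_one, where k = 0] by simp
  ultimately show ?thesis by fastforce
qed

section \<open>Linear extension of a map on a monoid to its monoid algebra\<close>

text \<open>The counterpart of \<open>char_ext\<close> with values in a possibly noncommutative
  algebra. No multiplicativity of \<chi> is assumed yet, since one later use is merely
  linear.\<close>

definition alg_ext :: "('m::monoid_add \<Rightarrow> 'a) \<Rightarrow> ('m \<Rightarrow>\<^sub>0 'k) \<Rightarrow> 'a" where
  "alg_ext \<chi> p = (\<Sum>m\<in>Poly_Mapping.keys p. scale (Poly_Mapping.lookup p m) (\<chi> m))"

lemma alg_ext_single [simp]: "alg_ext \<chi> (Poly_Mapping.single m c) = scale c (\<chi> m)"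
  by (simp add: alg_ext_def)

lemma alg_ext_superset:
  assumes "finite A" "Poly_Mapping.keys p \<subseteq> A"
  shows "alg_ext \<chi> p = (\<Sum>m\<in>A. scale (Poly_Mapping.lookup p m) (\<chi> m))"
  unfolding alg_ext_def using assms
  by (intro sum.mono_neutral_left) (auto simp: in_keys_iff)

lemma alg_ext_zero [simp]: "alg_ext \<chi> 0 = 0"
  by (simp add: alg_ext_def)

lemma alg_ext_add: "alg_ext \<chi> (p + q) = alg_ext \<chi> p + alg_ext \<chi> q"
proof -
  let ?A = "Poly_Mapping.keys p \<union> Poly_Mapping.keys q"
  have "Poly_Mapping.keys (p + q) \<subseteq> ?A" by (rule keys_add)
  then show ?thesis
    by (simp add: alg_ext_superset[of ?A] lookup_add scale_add_left sum.distrib)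
qed

lemma alg_ext_diff: "alg_ext \<chi> (p - q) = alg_ext \<chi> p - alg_ext \<chi> q"
  using alg_ext_add[of \<chi> "p - q" q] by simp

lemma alg_ext_sum: "alg_ext \<chi> (sum f A) = (\<Sum>a\<in>A. alg_ext \<chi> (f a))"
  by (induction A rule: infinite_finite_induct) (auto simp: alg_ext_add)

end

lemma poly_mapping_sum_single:
  "p = (\<Sum>m\<in>Poly_Mapping.keys p. Poly_Mapping.single m (Poly_Mapping.lookup p m))"
  by (rule poly_mapping_eqI) (auto simp: lookup_sum lookup_single when_def in_keys_iff)

text \<open>The universal property of the monoid algebra. It is used for words acting by operators
  and for monomials in X, Y, Z evaluated at z, \<omega>, \<theta>.\<close>

locale monoid_rep = unital_algebra scale
  for scale :: "'k::field \<Rightarrow> 'a::ring_1 \<Rightarrow> 'a" +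
  fixes \<chi> :: "'m::monoid_add \<Rightarrow> 'a"
  assumes chi_add: "\<chi> (m + n) = \<chi> m * \<chi> n" and chi_zero: "\<chi> 0 = 1"
begin

lemma alg_ext_mult: "alg_ext \<chi> (p * q) = alg_ext \<chi> p * alg_ext \<chi> q"
proof -
  have "p * q = (\<Sum>m\<in>Poly_Mapping.keys p. \<Sum>n\<in>Poly_Mapping.keys q.
      Poly_Mapping.single (m + n) (Poly_Mapping.lookup p m * Poly_Mapping.lookup q n))"
    by (subst poly_mapping_sum_single[of p], subst poly_mapping_sum_single[of q])
      (simp add: sum_product mult_single)
  then show ?thesis
    by (simp add: alg_ext_sum alg_ext_def[of _ p] alg_ext_def[of _ q] sum_product chi_add
        mult_scale_left mult_scale_right scale_scale mult_ac)
qed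

lemma alg_ext_one: "alg_ext \<chi> 1 = 1"
  using chi_zero by (simp flip: single_one add: scale_one)

lemma alg_ext_scalar: "alg_ext \<chi> (scalar c * p) = scale c (alg_ext \<chi> p)"
  using chi_zero by (simp add: alg_ext_mult scalar_def mult_scale_left)

text \<open>The kernel is a two-sided ideal, so it contains the ideal generated by \<open>S\<close>.
  This is how maps descend to the two quotient rings.\<close>

lemma alg_ext_ideal_cong:
  assumes S: "\<And>p. p \<in> S \<Longrightarrow> alg_ext \<chi> p = 0" and pq: "ideal_cong S p q"
  shows "alg_ext \<chi> p = alg_ext \<chi> q"
proof -
  have "two_sided_ideal {p. alg_ext \<chi> p = 0}"
    by (auto simp: two_sided_ideal_def alg_ext_mult alg_ext_add)
  then have "two_sided_ideal hull S \<subseteq> {p. alg_ext \<chi> p = 0}"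
    using S by (intro hull_minimal) auto
  then show ?thesis
    using pq by (auto simp: ideal_cong_def alg_ext_diff)
qed

end

section \<open>Linear operators on a monoid algebra\<close>

lemma lookup_scalar_mult:
  "Poly_Mapping.lookup (scalar c * p) m = c * Poly_Mapping.lookup p m"
proof -
  have "scalar c * p = (\<Sum>n\<in>Poly_Mapping.keys p.
      Poly_Mapping.single n (c * Poly_Mapping.lookup p n))"
    by (subst poly_mapping_sum_single[of p]) (simp add: scalar_def sum_distrib_left mult_single)
  then show ?thesis
    by (auto simp: lookup_sum lookup_single when_def in_keys_iff)
qed

lemma scalar_add: "scalar (c + d) = scalar c + scalar d"
  and scalar_mult: "scalar (c * d) = scalar c * scalar d"
  and scalar_one: "scalar 1 = 1"
  by (simp_all add: scalar_def single_add mult_single)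

text \<open>Scalars are supported at the neutral element of the monoid, which commutes with every
  word.\<close>

lemma scalar_commute: "p * scalar c = scalar c * p"
  by (subst (1 2) poly_mapping_sum_single[of p])
    (simp add: scalar_def sum_distrib_left sum_distrib_right mult_single mult.commute)

lemma scalar_numeral: "scalar (numeral n) = numeral n"
  by (simp add: scalar_def single_numeral)

interpretation monoid_algebra: unital_algebra "\<lambda>c p. scalar c * p"
  by unfold_locales
    (auto simp: scalar_add scalar_mult scalar_one algebra_simps,
      metis mult.assoc scalar_commute)

section \<open>The ring of linear operators\<close>

text \<open>A separate type makes composition the multiplication of a \<open>ring_1\<close>, so
  powers and commutators of operators obey the general ring lemmas.\<close>

typedef (overloaded) ('m, 'k) lin_op =
  "{f :: ('m::comm_monoid_add \<Rightarrow>\<^sub>0 'k::field) \<Rightarrow> ('m \<Rightarrow>\<^sub>0 'k).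
     (\<forall>a b. f (a + b) = f a + f b) \<and> (\<forall>c a. f (scalar c * a) = scalar c * f a)}"
  morphisms app Abs_lin_op
  by (rule exI[of _ "\<lambda>_. 0"]) simp

setup_lifting type_definition_lin_op

lemma lin_op_eqI: "(\<And>w. app S w = app T w) \<Longrightarrow> S = T"
  by (auto simp flip: app_inject)

instantiation lin_op :: (comm_monoid_add, field) ring_1
begin

lift_definition zero_lin_op :: "('a, 'b) lin_op" is "\<lambda>_. 0" by simp
lift_definition one_lin_op :: "('a, 'b) lin_op" is "\<lambda>a. a" by simp
lift_definition plus_lin_op :: "('a, 'b) lin_op \<Rightarrow> ('a, 'b) lin_op \<Rightarrow> ('a, 'b) lin_op"
  is "\<lambda>f g a. f a + g a" by (simp add: algebra_simps)
lift_definition minus_lin_op :: "('a, 'b) lin_op \<Rightarrow> ('a, 'b) lin_op \<Rightarrow> ('a, 'b) lin_op"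
  is "\<lambda>f g a. f a - g a" by (simp add: algebra_simps)
lift_definition uminus_lin_op :: "('a, 'b) lin_op \<Rightarrow> ('a, 'b) lin_op"
  is "\<lambda>f a. - f a" by (simp add: algebra_simps)
lift_definition times_lin_op :: "('a, 'b) lin_op \<Rightarrow> ('a, 'b) lin_op \<Rightarrow> ('a, 'b) lin_op"
  is "\<lambda>f g a. f (g a)" by simp

instance
proof
  show "(0 :: ('a, 'b) lin_op) \<noteq> 1"
    by transfer (metis zero_neq_one)
qed (transfer; simp add: algebra_simps; fail)+

end

lemma app_add: "app T (v + w) = app T v + app T w"
  and app_scalar: "app T (scalar c * w) = scalar c * app T w"
  by (transfer; simp)+

lemma app_zero [simp]: "app T 0 = 0"
  using app_add[of T 0 0] by simp

lemma app_minus: "app T (- w) = - app T w"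
  using app_add[of T w "- w"] by (simp add: minus_unique)

lemma app_diff: "app T (v - w) = app T v - app T w"
  using app_add[of T v "- w"] by (simp add: app_minus)

lemma app_sum: "app T (sum f A) = (\<Sum>i\<in>A. app T (f i))"
  by (induction A rule: infinite_finite_induct) (auto simp: app_add)

lift_definition scale_op :: "'k::field \<Rightarrow> ('m::comm_monoid_add, 'k) lin_op \<Rightarrow> ('m, 'k) lin_op"
  is "\<lambda>c f a. scalar c * f a"
  by (simp add: algebra_simps)

lemmas app_simps [simp] = zero_lin_op.rep_eq one_lin_op.rep_eq plus_lin_op.rep_eq
  minus_lin_op.rep_eq uminus_lin_op.rep_eq times_lin_op.rep_eq scale_op.rep_eq

lemma app_sum_left: "app (sum f A) w = (\<Sum>i\<in>A. app (f i) w)"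
  by (induction A rule: infinite_finite_induct) simp_all

interpretation lin_op: unital_algebra scale_op
  by unfold_locales
    (auto intro!: lin_op_eqI simp: scalar_add scalar_mult scalar_one app_scalar algebra_simps)

definition mult_op :: "('m::comm_monoid_add \<Rightarrow>\<^sub>0 'k::field) \<Rightarrow> ('m, 'k) lin_op" where
  "mult_op w = Abs_lin_op ((*) w)"

lemma app_mult_op [simp]: "app (mult_op w) v = w * v"
  unfolding mult_op_def by (subst Abs_lin_op_inverse) (simp_all add: algebra_simps)

lemma mult_op_zero: "mult_op 0 = 0"
  by (rule lin_op_eqI) simp

lemma mult_op_add: "mult_op (v + w) = mult_op v + mult_op w"
  and mult_op_mult: "mult_op (v * w) = mult_op v * mult_op w"
  and mult_op_one: "mult_op 1 = 1"
  and mult_op_scalar: "mult_op (scalar c * w) = scale_op c (mult_op w)"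
  by (auto intro!: lin_op_eqI simp: algebra_simps)

lemma mult_op_power: "mult_op w ^ n = mult_op (w ^ n)"
  by (induction n) (simp_all add: mult_op_one mult_op_mult)

text \<open>For additive \<open>\<psi>\<close> this is the derivation of the monoid algebra acting on the monomial \<open>m\<close>
  as multiplication by \<open>\<psi> m\<close>.\<close>

lift_definition weight_op :: "('m::comm_monoid_add \<Rightarrow> 'k::field) \<Rightarrow> ('m, 'k) lin_op"
  is "\<lambda>\<psi>. Poly_Mapping.mapp (\<lambda>m c. \<psi> m * c)"
proof (intro conjI allI)
  have *: "Poly_Mapping.lookup (Poly_Mapping.mapp (\<lambda>m c. \<psi> m * c) a) m
      = \<psi> m * Poly_Mapping.lookup a m"
    for \<psi> :: "'m \<Rightarrow> 'k" and a m
    by (simp add: lookup_mapp when_def in_keys_iff)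
  show "Poly_Mapping.mapp (\<lambda>m c. \<psi> m * c) (a + b) =
      Poly_Mapping.mapp (\<lambda>m c. \<psi> m * c) a
          + Poly_Mapping.mapp (\<lambda>m c. \<psi> m * c) b"
    for \<psi> :: "'m \<Rightarrow> 'k" and a b
    by (rule poly_mapping_eqI) (simp add: * lookup_add distrib_left)
  show "Poly_Mapping.mapp (\<lambda>m c. \<psi> m * c) (scalar d * a) =
      scalar d * Poly_Mapping.mapp (\<lambda>m c. \<psi> m * c) a"
    for \<psi> :: "'m \<Rightarrow> 'k" and d a
    by (rule poly_mapping_eqI) (simp add: * lookup_scalar_mult)
qed

lemma lookup_weight_op:
  "Poly_Mapping.lookup (app (weight_op \<psi>) w) m = \<psi> m * Poly_Mapping.lookup w m"
  by (simp add: weight_op.rep_eq lookup_mapp when_def in_keys_iff)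

lemma weight_op_single:
  "app (weight_op \<psi>) (Poly_Mapping.single m c) = Poly_Mapping.single m (\<psi> m * c)"
  by (rule poly_mapping_eqI) (simp add: lookup_weight_op lookup_single when_def)

text \<open>On a product of two monomials the Leibniz rule is additivity of \<psi>; both sides are
  biadditive, so it extends to sums.\<close>

lemma weight_op_mult:
  assumes "\<And>m n. \<psi> (m + n) = \<psi> m + \<psi> n"
  shows "app (weight_op \<psi>) (v * w) = app (weight_op \<psi>) v * w + v * app (weight_op \<psi>) w"
proof -
  have "app (weight_op \<psi>) (Poly_Mapping.single m c * Poly_Mapping.single n d) =
      app (weight_op \<psi>) (Poly_Mapping.single m c) * Poly_Mapping.single n d
      + Poly_Mapping.single m c * app (weight_op \<psi>) (Poly_Mapping.single n d)" for m n c d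
    by (simp add: mult_single weight_op_single assms algebra_simps flip: single_add)
  then have "app (weight_op \<psi>) ((\<Sum>m\<in>I. Poly_Mapping.single m (c m)) * (\<Sum>n\<in>J. Poly_Mapping.single n (d n))) =
      app (weight_op \<psi>) (\<Sum>m\<in>I. Poly_Mapping.single m (c m)) * (\<Sum>n\<in>J. Poly_Mapping.single n (d n))
      + (\<Sum>m\<in>I. Poly_Mapping.single m (c m)) * app (weight_op \<psi>) (\<Sum>n\<in>J. Poly_Mapping.single n (d n))"
    for I c J d
    by (simp add: sum_product app_sum sum.distrib)
  from this[where I = "Poly_Mapping.keys v" and c = "Poly_Mapping.lookup v"
      and J = "Poly_Mapping.keys w" and d = "Poly_Mapping.lookup w"]
  show ?thesis
    by (simp only: poly_mapping_sum_single[symmetric])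
qed

lemma weight_op_commute: "weight_op \<psi> * weight_op \<phi> = weight_op \<phi> * weight_op \<psi>"
  by (auto intro!: lin_op_eqI poly_mapping_eqI simp: lookup_weight_op)

section \<open>The representation on Laurent polynomials\<close>

text \<open>The exponents of a monomial \<open>a\<^sup>i b\<^sup>j x\<^sup>m h\<^sup>n\<close>.\<close>

type_synonym exps = "int \<times> int \<times> int \<times> int"

type_synonym 'k laurent = "exps \<Rightarrow>\<^sub>0 'k"

definition mon :: "int \<Rightarrow> int \<Rightarrow> int \<Rightarrow> int \<Rightarrow> 'k::field laurent" where
  "mon i j m n = Poly_Mapping.single (i, j, m, n) 1"

definition va :: "'k::field laurent" where "va = mon 1 0 0 0"
definition vb :: "'k::field laurent" where "vb = mon 0 1 0 0"
definition vx :: "'k::field laurent" where "vx = mon 0 0 1 0"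
definition vh :: "'k::field laurent" where "vh = mon 0 0 0 1"
text \<open>The operators representing the generators do not contain the inverses of a and b. They
  are there to form the derivatives d/da and d/db and to recover h from u.\<close>

definition va' :: "'k::field laurent" where "va' = mon (-1) 0 0 0"
definition vb' :: "'k::field laurent" where "vb' = mon 0 (-1) 0 0"
definition vx' :: "'k::field laurent" where "vx' = mon 0 0 (-1) 0"
definition vh' :: "'k::field laurent" where "vh' = mon 0 0 0 (-1)"

text \<open>The Euler operators a d/da, b d/db, x d/dx, h d/dh. The last two represent generators;
  the first two separate u and v in the proof of faithfulness.\<close>

definition Ea :: "(exps, 'k::field) lin_op" where "Ea = weight_op (\<lambda>(i, j, m, n). of_int i)"
definition Eb :: "(exps, 'k::field) lin_op" where "Eb = weight_op (\<lambda>(i, j, m, n). of_int j)"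
definition Ex :: "(exps, 'k::field) lin_op" where "Ex = weight_op (\<lambda>(i, j, m, n). of_int m)"
definition Eh :: "(exps, 'k::field) lin_op" where "Eh = weight_op (\<lambda>(i, j, m, n). of_int n)"

lemma mon_mult: "mon i j m n * mon i' j' m' n' = mon (i + i') (j + j') (m + m') (n + n')"
  by (simp add: mon_def mult_single)

lemma mon_zero: "mon 0 0 0 0 = 1"
  by (simp add: mon_def flip: zero_prod_def single_one)

lemma va_inverse: "va * va' = 1" and vb_inverse: "vb * vb' = 1"
  and vx_inverse: "vx * vx' = 1" and vh_inverse: "vh * vh' = 1"
  by (simp_all add: va_def va'_def vb_def vb'_def vx_def vx'_def vh_def vh'_def mon_mult mon_zero)

lemma euler_mult:
  "app Ea (v * w) = app Ea v * w + v * app Ea w"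
  "app Eb (v * w) = app Eb v * w + v * app Eb w"
  "app Ex (v * w) = app Ex v * w + v * app Ex w"
  "app Eh (v * w) = app Eh v * w + v * app Eh w"
  unfolding Ea_def Eb_def Ex_def Eh_def by (rule weight_op_mult; clarsimp)+

lemma euler_mon:
  "app Ea (mon i j m n) = scalar (of_int i) * mon i j m n"
  "app Eb (mon i j m n) = scalar (of_int j) * mon i j m n"
  "app Ex (mon i j m n) = scalar (of_int m) * mon i j m n"
  "app Eh (mon i j m n) = scalar (of_int n) * mon i j m n"
  unfolding Ea_def Eb_def Ex_def Eh_def mon_def
  by (simp_all add: weight_op_single scalar_def mult_single zero_prod_def)

lemma scalar_minus: "scalar (- c) = - scalar c"
  by (simp add: scalar_def single_uminus)

lemma scalar_zero: "scalar 0 = 0"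
  by (simp add: scalar_def)

lemma euler_vars:
  "app Ea va = va" "app Ea vb = 0" "app Ea vx = 0" "app Ea vh = 0" "app Ea va'
      = - va'" "app Ea vb' = 0" "app Ea vx' = 0" "app Ea vh' = 0"
  "app Eb va = 0" "app Eb vb = vb" "app Eb vx = 0" "app Eb vh = 0" "app Eb va' = 0" "app Eb vb'
      = - vb'" "app Eb vx' = 0" "app Eb vh' = 0"
  "app Ex va = 0" "app Ex vb = 0" "app Ex vx = vx" "app Ex vh = 0" "app Ex va' = 0" "app Ex vb'
      = 0" "app Ex vx' = - vx'" "app Ex vh' = 0"
  "app Eh va = 0" "app Eh vb = 0" "app Eh vx = 0" "app Eh vh = vh" "app Eh va' = 0" "app Eh vb'
      = 0" "app Eh vx' = 0" "app Eh vh' = - vh'"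
  unfolding va_def va'_def vb'_def vb_def vx_def vh_def vx'_def vh'_def
  by (simp_all add: euler_mon scalar_one scalar_minus scalar_zero)

lemma euler_one: "app Ea 1 = 0" "app Eb 1 = 0" "app Ex 1 = 0" "app Eh 1 = 0"
  unfolding mon_zero[symmetric] by (simp_all add: euler_mon scalar_zero)

lemma euler_scalar:
  "app Ea (scalar c) = 0" "app Eb (scalar c) = 0" "app Ex (scalar c) = 0" "app Eh (scalar c) = 0"
  using app_scalar[of Ea c 1] app_scalar[of Eb c 1] app_scalar[of Ex c 1] app_scalar[of Eh c 1]
  by (simp_all add: euler_one)

lemma app_numeral: "app T (numeral k) = numeral k * app T 1"
  using app_scalar[of T "numeral k" 1] by (simp add: scalar_numeral)

lemma euler_numeral:
  "app Ea (numeral k) = 0" "app Eb (numeral k) = 0" "app Ex (numeral k) = 0" "app Eh (numeral k) = 0"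
  by (simp_all add: app_numeral euler_one)

lemma euler_commute:
  "app Eh (app Ex w) = app Ex (app Eh w)"
  "app Ea (app Ex w) = app Ex (app Ea w)"
  "app Eb (app Ex w) = app Ex (app Eb w)"
  "app Ea (app Eh w) = app Eh (app Ea w)"
  "app Eb (app Eh w) = app Eh (app Eb w)"
  using arg_cong[OF weight_op_commute, of "\<lambda>T. app T w"]
  unfolding Ea_def Eb_def Ex_def Eh_def by simp_all

definition u_poly :: "'k::field laurent" where
  "u_poly = vx' * (va * vh - 2 - 2 * vh ^ 2)"

text \<open>The formula for \<open>v\<close> is the equation \<open>s
    = b h\<close> solved for \<open>v\<close>, just as the one for \<open>u\<close>
  solves \<open>q = a h\<close>, where \<open>h\<^sup>2 = g\<close>.\<close>

fun rho_gen :: "double_gen \<Rightarrow> (exps, 'k::field) lin_op" where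
  "rho_gen Gen_x = mult_op vx"
| "rho_gen Gen_g = mult_op (vh ^ 2)"
| "rho_gen Gen_ginv = mult_op (vh' ^ 2)"
| "rho_gen Gen_zeta = Ex"
| "rho_gen Gen_y = - scale_op (1/2) (mult_op vx * (Ex + Eh))"
| "rho_gen Gen_u = mult_op u_poly"
| "rho_gen Gen_v = mult_op (vx' * (vb * vh + 2 + 2 * vh ^ 2))
     + mult_op u_poly * (Ex + scale_op (1/2) Eh) + mult_op (vx' * (1 - vh ^ 2)) * Ex"

section \<open>Verification of the defining relations\<close>

lemmas rho_expand = euler_mult euler_vars euler_one euler_numeral euler_commute app_add app_diff
  app_minus app_scalar power2_eq_square u_poly_def

text \<open>To ring normalization \<open>scalar (1/2)\<close> is an opaque element, so its
  cancellation against even numerals has to be supplied.\<close>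

lemma half: "2 * scalar (1/2) = (1 :: 'k::field_char_0 laurent)"
proof -
  have "(scalar (2 * (1/2)) :: 'k laurent) = scalar 2 * scalar (1/2)" by (rule scalar_mult)
  then show ?thesis by (simp add: scalar_numeral scalar_one)
qed

lemma numeral_half:
  "numeral (Num.Bit0 n) * scalar (1/2 :: 'k::field_char_0) = (numeral n :: 'k laurent)"
  "numeral (Num.Bit0 n) * (scalar (1/2 :: 'k) * w) = (numeral n * w :: 'k laurent)"
proof -
  have "numeral (Num.Bit0 n) = 2 * (numeral n :: 'k laurent)"
    by (simp only: numeral_Bit0[of n] mult_2)
  then have "numeral (Num.Bit0 n) * scalar (1/2) = 2 * (numeral n :: 'k laurent) * scalar (1/2)"
    by (rule arg_cong)
  also have "\<dots> = (2 * scalar (1/2)) * (numeral n :: 'k laurent)"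
    by (simp only: mult_ac)
  finally show *: "numeral (Num.Bit0 n) * scalar (1/2 :: 'k) = (numeral n :: 'k laurent)"
    by (simp only: half mult_1_left)
  show "numeral (Num.Bit0 n) * (scalar (1/2 :: 'k) * w) = (numeral n * w :: 'k laurent)"
    by (simp only: * flip: mult.assoc)
qed

text \<open>These are the shapes in which halves survive normalization: next to an even numeral, or
  as two equal half terms that add up to a whole one.\<close>

lemma half_collect:
  fixes w t :: "'k::field_char_0 laurent"
  shows "numeral (Num.Bit0 n) * (w * scalar (1/2 :: 'k)) = numeral n * w"
    and "numeral (Num.Bit0 n) * (w * (scalar (1/2 :: 'k) * scalar (1/2)))
        = numeral n * (w * scalar (1/2))"
    and "numeral (Num.Bit0 n) * (v * (v' * (w * scalar (1/2 :: 'k)))) = numeral n * (v * (v' * w))"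
    and "w * scalar (1/2) + w * scalar (1/2) = w"
    and "w * scalar (1/2) + (w * scalar (1/2) + t) = w + t"
    and "v * (v' * (w * scalar (1/2))) + v * (v' * (w * scalar (1/2))) = v * (v' * w)"
    and "v * (v' * (w * scalar (1/2))) + (v * (v' * (w * scalar (1/2))) + t) = v * (v' * w) + t"
proof -
  show *: "w * scalar (1/2) + w * scalar (1/2) = w" for w :: "'k laurent"
    using arg_cong[OF half[where ?'k = 'k], of "(*) w"] by (simp only: mult_2 distrib_left mult_1_right)
  then show **: "v * (v' * (w * scalar (1/2))) + v * (v' * (w * scalar (1/2))) = v * (v' * w)"
    by (simp only: flip: distrib_left)
  show "w * scalar (1/2) + (w * scalar (1/2) + t) = w + t"
    "v * (v' * (w * scalar (1/2))) + (v * (v' * (w * scalar (1/2))) + t) = v * (v' * w) + t"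
    by (simp_all only: * ** flip: add.assoc)
  show "numeral (Num.Bit0 n) * (w * scalar (1/2 :: 'k)) = numeral n * w"
    "numeral (Num.Bit0 n) * (v * (v' * (w * scalar (1/2 :: 'k)))) = numeral n * (v * (v' * w))"
    "numeral (Num.Bit0 n) * (w * (scalar (1/2 :: 'k) * scalar (1/2))) = numeral n * (w * scalar (1/2))"
    unfolding mult.left_commute[of "numeral (Num.Bit0 n)" w] mult.left_commute[of "numeral (Num.Bit0 n)" v]
      mult.left_commute[of "numeral (Num.Bit0 n)" v'] numeral_half
    by (simp_all only: mult.left_commute mult.commute)
qed

lemma cancel_inverse:
  "va * (va' * w) = w" "vb * (vb' * w) = w" "vx * (vx' * w) = w" "vh * (vh' * w) = w"
  by (simp_all add: va_inverse vb_inverse vx_inverse vh_inverse flip: mult.assoc)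

lemmas rho_collect = algebra_simps va_inverse vb_inverse vx_inverse vh_inverse cancel_inverse numeral_half
  numeral_half[unfolded mult.commute[of _ "scalar (1/2)"]]

text \<open>Apply both sides to an arbitrary Laurent polynomial and move the Euler operators inward
  by the Leibniz rule. What remains is an identity in a commutative ring, with derivatives of the
  argument as unknowns.\<close>

lemma rho_gen_relations:
  fixes \<rho> :: "double_gen \<Rightarrow> (exps, 'k::field_char_0) lin_op"
  defines "\<rho> \<equiv> rho_gen"
  shows "\<rho> Gen_g * \<rho> Gen_ginv = 1"
    and "\<rho> Gen_ginv * \<rho> Gen_g = 1"
    and "\<rho> Gen_zeta * \<rho> Gen_g = \<rho> Gen_g * \<rho> Gen_zeta"
    and "\<rho> Gen_g * \<rho> Gen_x = \<rho> Gen_x * \<rho> Gen_g"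
    and "\<rho> Gen_g * \<rho> Gen_y = \<rho> Gen_y * \<rho> Gen_g + \<rho> Gen_x * \<rho> Gen_g"
    and "\<rho> Gen_zeta * \<rho> Gen_y = \<rho> Gen_y * \<rho> Gen_zeta + \<rho> Gen_y"
    and "\<rho> Gen_zeta * \<rho> Gen_x = \<rho> Gen_x * \<rho> Gen_zeta + \<rho> Gen_x"
    and "\<rho> Gen_u * \<rho> Gen_g = \<rho> Gen_g * \<rho> Gen_u"
    and "\<rho> Gen_v * \<rho> Gen_g = \<rho> Gen_g * \<rho> Gen_v + \<rho> Gen_g * \<rho> Gen_u"
    and "\<rho> Gen_v * \<rho> Gen_zeta = \<rho> Gen_zeta * \<rho> Gen_v + \<rho> Gen_v"
    and "\<rho> Gen_u * \<rho> Gen_zeta = \<rho> Gen_zeta * \<rho> Gen_u + \<rho> Gen_u"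
    and "\<rho> Gen_y * \<rho> Gen_x = \<rho> Gen_x * \<rho> Gen_y - scale_op (1/2) (\<rho> Gen_x ^ 2)"
    and "\<rho> Gen_v * \<rho> Gen_u = \<rho> Gen_u * \<rho> Gen_v - scale_op (1/2) (\<rho> Gen_u ^ 2)"
    and "\<rho> Gen_u * \<rho> Gen_x = \<rho> Gen_x * \<rho> Gen_u"
    and "\<rho> Gen_v * \<rho> Gen_x
        = \<rho> Gen_x * \<rho> Gen_v + (1 - \<rho> Gen_g) + \<rho> Gen_x * \<rho> Gen_u"
    and "\<rho> Gen_u * \<rho> Gen_y = \<rho> Gen_y * \<rho> Gen_u + (1 - \<rho> Gen_g)"
    and "\<rho> Gen_v * \<rho> Gen_y
        = \<rho> Gen_y * \<rho> Gen_v - \<rho> Gen_g * \<rho> Gen_zeta + \<rho> Gen_y * \<rho> Gen_u"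
  unfolding \<rho>_def
by (rule lin_op_eqI, simp add: rho_expand; (simp add: rho_collect)?; (simp add: half_collect)?)+

section \<open>The double of the Jordan plane as an iterated Ore extension\<close>

interpretation D: unital_algebra scale_D
proof
  fix c d :: "'a::field" and a b :: "'a double_jordan"
  show "scale_D (c + d) a = scale_D c a + scale_D d a"
    by transfer (simp add: scalar_add distrib_right ideal_cong_refl)
  show "scale_D c (a + b) = scale_D c a + scale_D c b"
    by transfer (simp add: distrib_left ideal_cong_refl)
  show "scale_D c (scale_D d a) = scale_D (c * d) a"
    by transfer (simp add: scalar_mult mult.assoc ideal_cong_refl)
  show "scale_D 1 a = a"
    by transfer (simp add: scalar_one ideal_cong_refl)
  show "scale_D c a * b = scale_D c (a * b)"
    by transfer (simp add: mult.assoc ideal_cong_refl)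
  show "a * scale_D c b = scale_D c (a * b)"
    by transfer (simp add: ideal_cong_refl scalar_commute flip: mult.assoc)
qed

lemma gen_D_relations:
  fixes \<gamma> :: "double_gen \<Rightarrow> 'k::field double_jordan"
  defines "\<gamma> \<equiv> gen_D"
  shows "\<gamma> Gen_g * \<gamma> Gen_ginv = 1"
    and "\<gamma> Gen_ginv * \<gamma> Gen_g = 1"
    and "\<gamma> Gen_zeta * \<gamma> Gen_g = \<gamma> Gen_g * \<gamma> Gen_zeta"
    and "\<gamma> Gen_g * \<gamma> Gen_x = \<gamma> Gen_x * \<gamma> Gen_g"
    and "\<gamma> Gen_g * \<gamma> Gen_y
        = \<gamma> Gen_y * \<gamma> Gen_g + \<gamma> Gen_x * \<gamma> Gen_g"
    and "\<gamma> Gen_zeta * \<gamma> Gen_y = \<gamma> Gen_y * \<gamma> Gen_zeta + \<gamma> Gen_y"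
    and "\<gamma> Gen_zeta * \<gamma> Gen_x = \<gamma> Gen_x * \<gamma> Gen_zeta + \<gamma> Gen_x"
    and "\<gamma> Gen_u * \<gamma> Gen_g = \<gamma> Gen_g * \<gamma> Gen_u"
    and "\<gamma> Gen_v * \<gamma> Gen_g
        = \<gamma> Gen_g * \<gamma> Gen_v + \<gamma> Gen_g * \<gamma> Gen_u"
    and "\<gamma> Gen_v * \<gamma> Gen_zeta = \<gamma> Gen_zeta * \<gamma> Gen_v + \<gamma> Gen_v"
    and "\<gamma> Gen_u * \<gamma> Gen_zeta = \<gamma> Gen_zeta * \<gamma> Gen_u + \<gamma> Gen_u"
    and "\<gamma> Gen_y * \<gamma> Gen_x
        = \<gamma> Gen_x * \<gamma> Gen_y - scale_D (1/2) (\<gamma> Gen_x ^ 2)"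
    and "\<gamma> Gen_v * \<gamma> Gen_u
        = \<gamma> Gen_u * \<gamma> Gen_v - scale_D (1/2) (\<gamma> Gen_u ^ 2)"
    and "\<gamma> Gen_u * \<gamma> Gen_x = \<gamma> Gen_x * \<gamma> Gen_u"
    and "\<gamma> Gen_v * \<gamma> Gen_x
        = \<gamma> Gen_x * \<gamma> Gen_v + (1 - \<gamma> Gen_g) + \<gamma> Gen_x * \<gamma> Gen_u"
    and "\<gamma> Gen_u * \<gamma> Gen_y = \<gamma> Gen_y * \<gamma> Gen_u + (1 - \<gamma> Gen_g)"
    and "\<gamma> Gen_v * \<gamma> Gen_y
        = \<gamma> Gen_y * \<gamma> Gen_v - \<gamma> Gen_g * \<gamma> Gen_zeta + \<gamma> Gen_y * \<gamma> Gen_u"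
  unfolding \<gamma>_def power2_eq_square
  by (transfer, rule ideal_cong_rel, simp add: double_rels_def Let_def power2_eq_square; fail)+

section \<open>The representation of the double\<close>

fun rho_word :: "double_gen free_monoid \<Rightarrow> (exps, 'k::field) lin_op" where
  "rho_word (Word w) = prod_list (map rho_gen w)"

interpretation rho_word: monoid_rep scale_op rho_word
proof
  show "rho_word (m + n) = rho_word m * rho_word n" for m n
    by (cases m; cases n) simp
qed (simp add: zero_free_monoid_def)

text \<open>A representative in the free algebra is chosen; \<open>rho_abs\<close> shows that the
  choice does not matter.\<close>

definition rho :: "'k::field double_jordan \<Rightarrow> (exps, 'k) lin_op" where
  "rho d = lin_op.alg_ext rho_word (rep_double_jordan d)"

text \<open>Each relator is the difference of two sides that agree by
  \<open>rho_gen_relations\<close>, so the extension to the free algebra kills the ideal.\<close>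

lemma rho_abs:
  fixes p :: "(double_gen, 'k::field_char_0) free_algebra"
  shows "rho (abs_double_jordan p) = lin_op.alg_ext rho_word p"
  unfolding rho_def
proof (rule rho_word.alg_ext_ideal_cong)
  show "lin_op.alg_ext rho_word r = 0" if "r \<in> double_rels" for r :: "(double_gen, 'k) free_algebra"
  proof -
    have gen: "lin_op.alg_ext rho_word (free_gen a) = (rho_gen a :: (exps, 'k) lin_op)" for a
      by (simp add: free_gen_def lin_op.scale_one)
    have scal: "lin_op.alg_ext rho_word (scalar c) = (scale_op c 1 :: (exps, 'k) lin_op)" for c
      using rho_word.alg_ext_scalar[of c 1] by (simp add: rho_word.alg_ext_one)
    show ?thesis
      using that rho_gen_relations[where ?'k = 'k] unfolding double_rels_def Let_def
      by (elim insertE)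
        (simp_all only: lin_op.alg_ext_diff lin_op.alg_ext_add rho_word.alg_ext_mult
          rho_word.alg_ext_one scal lin_op.mult_scale_left mult_1_left gen power2_eq_square empty_iff simp_thms
          cancel_comm_monoid_add_class.diff_cancel)
  qed
  show "ideal_cong double_rels (rep_double_jordan (abs_double_jordan p)) p"
    by (rule rep_abs_rsp_left[OF Quotient3_double_jordan]) (rule ideal_cong_refl)
qed

lemma rho_hom:
  fixes a b :: "'k::field_char_0 double_jordan"
  shows rho_add: "rho (a + b) = rho a + rho b"
    and rho_diff: "rho (a - b) = rho a - rho b"
    and rho_mult: "rho (a * b) = rho a * rho b"
    and rho_one: "rho (1 :: 'k double_jordan) = 1"
    and rho_scale: "rho (scale_D c a) = scale_op c (rho a)"
    and rho_gen_D: "rho (gen_D i :: 'k double_jordan) = rho_gen i"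
proof -
  obtain p q where pq: "a = abs_double_jordan p" "b = abs_double_jordan q"
    by (metis Quotient3_abs_rep[OF Quotient3_double_jordan])
  show "rho (a + b) = rho a + rho b" "rho (a - b) = rho a - rho b" "rho (a * b) = rho a * rho b"
    "rho (1 :: 'k double_jordan) = 1"
    "rho (gen_D i :: 'k double_jordan) = rho_gen i"
    by (simp_all add: pq rho_abs plus_double_jordan.abs_eq minus_double_jordan.abs_eq
        times_double_jordan.abs_eq one_double_jordan_def gen_D.abs_eq lin_op.alg_ext_add
        lin_op.alg_ext_diff rho_word.alg_ext_mult rho_word.alg_ext_one free_gen_def lin_op.scale_one)
  show "rho (scale_D c a) = scale_op c (rho a)"
    by (simp only: pq rho_abs scale_D.abs_eq rho_word.alg_ext_scalar)
qed

lemma rho_zero: "rho (0 :: 'k::field_char_0 double_jordan) = 0"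
  using rho_diff[of 0 0] by simp

lemma rho_power: "rho (a ^ n :: 'k::field_char_0 double_jordan) = rho a ^ n"
  by (induction n) (simp_all add: rho_one rho_mult)

lemma rho_sum: "rho (sum f A :: 'k::field_char_0 double_jordan) = (\<Sum>i\<in>A. rho (f i))"
  by (induction A rule: infinite_finite_induct) (simp_all add: rho_zero rho_add)

text \<open>Every class is a linear combination of words, and words are products of generators.
  Hence a property that defines a subalgebra need only be checked on generators.\<close>

lemma gen_range_gen_D: "(d :: 'k::field double_jordan) \<in> D.gen (range gen_D)"
proof -
  have word: "abs_double_jordan (Poly_Mapping.single (Word w) 1) \<in> D.gen (range (gen_D :: _ \<Rightarrow> 'k double_jordan))" for w
  proof (induction w)
    case Nil
    have "abs_double_jordan (Poly_Mapping.single (Word []) 1) = (1 :: 'k double_jordan)"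
      by (simp add: one_double_jordan_def flip: zero_free_monoid_def single_one)
    then show ?case using D.gen_one by metis
  next
    case (Cons i w)
    have "Poly_Mapping.single (Word (i # w)) (1 :: 'k) = free_gen i * Poly_Mapping.single (Word w) 1"
      by (simp add: free_gen_def mult_single)
    then have "abs_double_jordan (Poly_Mapping.single (Word (i # w)) 1) =
        (gen_D i :: 'k double_jordan) * abs_double_jordan (Poly_Mapping.single (Word w) 1)"
      by (simp add: gen_D.abs_eq times_double_jordan.abs_eq)
    then show ?case using Cons by (metis D.gen_mult D.gen_base rangeI)
  qed
  have "abs_double_jordan p \<in> D.gen (range (gen_D :: _ \<Rightarrow> 'k double_jordan))" for p
  proof -
    have "abs_double_jordan (\<Sum>m\<in>A. Poly_Mapping.single m (c m)) \<in> D.gen (range (gen_D :: _ \<Rightarrow> 'k double_jordan))"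
      if "finite A" for A c
      using that
    proof (induction A)
      case empty
      then show ?case using D.gen_zero by (simp add: zero_double_jordan_def[symmetric])
    next
      case (insert m A)
      obtain w where w: "m = Word w" by (cases m)
      have "Poly_Mapping.single m (c m) = scalar (c m) * Poly_Mapping.single (Word w) 1"
        by (simp add: scalar_def mult_single w)
      then have "abs_double_jordan (Poly_Mapping.single m (c m)) \<in> D.gen (range (gen_D :: _ \<Rightarrow> 'k double_jordan))"
        using D.gen_scale[OF word] by (metis scale_D.abs_eq)
      then show ?case
        using insert by (simp add: D.gen_add flip: plus_double_jordan.abs_eq)
    qed
    then show ?thesis
      by (subst poly_mapping_sum_single[of p]) simp
  qed
  then show ?thesis by (metis Quotient3_abs_rep[OF Quotient3_double_jordan])
qed

section \<open>Faithfulness of the representation\<close>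

definition ad :: "'a::ring_1 \<Rightarrow> 'a \<Rightarrow> 'a" where
  "ad P a = P * a - a * P"

lemma ad_mult: "ad P (a * b) = ad P a * b + a * ad P b"
  and ad_add: "ad P (a + b) = ad P a + ad P b"
  by (simp_all add: ad_def algebra_simps)

lemma ad_pow_zero: "(ad P ^^ n) 0 = 0"
  by (induction n) (simp_all add: ad_def)

lemma ad_pow_add: "(ad P ^^ n) (a + b) = (ad P ^^ n) a + (ad P ^^ n) b"
  by (induction n) (simp_all add: ad_add)

lemma ad_pow_sum: "(ad P ^^ n) (sum f A) = (\<Sum>i\<in>A. (ad P ^^ n) (f i))"
  by (induction A rule: infinite_finite_induct) (simp_all add: ad_pow_zero ad_pow_add)

lemma ad_pow_commuting_mult:
  "ad P d = 0 \<Longrightarrow> (ad P ^^ n) (d * w) = d * (ad P ^^ n) w"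
  by (induction n) (simp_all add: ad_mult)

lemma ad_of_nat: "ad P (of_nat n) = 0"
  by (simp add: ad_def mult_of_nat_commute)

text \<open>The Leibniz expansion stops after two terms because the second commutator of
  \<open>t\<close> vanishes.\<close>

lemma ad_pow_mult:
  assumes "ad P (ad P t) = 0"
  shows "(ad P ^^ Suc n) (t * w) = t * (ad P ^^ Suc n) w + of_nat (Suc n) * (ad P t * (ad P ^^ n) w)"
proof (induction n)
  case (Suc n)
  have "(ad P ^^ Suc (Suc n)) (t * w) = ad P ((ad P ^^ Suc n) (t * w))" by simp
  also have "\<dots> = ad P t * (ad P ^^ Suc n) w + t * (ad P ^^ Suc (Suc n)) w
      + of_nat (Suc n) * (ad P t * (ad P ^^ Suc n) w)"
    unfolding Suc ad_add ad_mult ad_of_nat assms by simp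
  finally show ?case by (simp add: algebra_simps)
qed (simp add: ad_mult)

text \<open>As for the k-th derivative of a k-th power. No commutation of \<open>t\<close> with
  \<open>ad P t\<close> is required: in the expansion of \<open>t * t ^ k\<close> the term that
  keeps \<open>t\<close> in front contains one commutator too many and is zero.\<close>

lemma ad_pow_power:
  assumes "ad P (ad P t) = 0"
  shows "(ad P ^^ k) (t ^ k) = of_nat (fact k) * ad P t ^ k"
    and "n > k \<Longrightarrow> (ad P ^^ n) (t ^ k) = 0"
proof -
  have 0: "n > k \<Longrightarrow> (ad P ^^ n) (t ^ k) = 0" for n k
  proof (induction k arbitrary: n)
    case 0
    then obtain m where "n = Suc m" using gr0_conv_Suc by auto
    then show ?case using ad_pow_zero[where n = m and P = P] ad_of_nat[of P 1]
      by (simp only: funpow_Suc_right o_apply power_0 of_nat_1)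
  next
    case (Suc k)
    then obtain m where "n = Suc m" "m > k" by (auto elim: Suc_lessE)
    then show ?case using Suc.IH by (simp only: power_Suc ad_pow_mult[OF assms]) simp
  qed
  then show "n > k \<Longrightarrow> (ad P ^^ n) (t ^ k) = 0" .
  show "(ad P ^^ k) (t ^ k) = of_nat (fact k) * ad P t ^ k"
  proof (induction k)
    case (Suc k)
    have comm: "ad P t * (of_nat (fact k) * w) = of_nat (fact k) * (ad P t * w)" for w
      by (simp only: mult.assoc[symmetric] mult_of_nat_commute[of "fact k" "ad P t"])
    have "(ad P ^^ Suc k) (t ^ Suc k) = of_nat (Suc k) * (ad P t * (of_nat (fact k) * ad P t ^ k))"
      unfolding power_Suc[of t] ad_pow_mult[OF assms] Suc using 0[of k "Suc k"] by simp
    also have "\<dots> = of_nat (Suc k) * of_nat (fact k) * (ad P t * ad P t ^ k)"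
      by (simp only: comm mult.assoc)
    finally show ?case by (simp only: fact_Suc of_nat_mult of_nat_id power_Suc)
  qed simp
qed

section \<open>Faithfulness is preserved when a generator is adjoined\<close>

definition faithful_on :: "'k::field_char_0 double_jordan set \<Rightarrow> bool" where
  "faithful_on B \<longleftrightarrow> (\<forall>d\<in>B. rho d = 0 \<longrightarrow> d = 0)"

text \<open>Applying \<open>ad P\<close> exactly \<open>N\<close> times to a relation \<open>\<Sum>\<^sub>k\<^sub>\<le>\<^sub>N d\<^sub>k t\<^sup>k = 0\<close> isolates \<open>N! d\<^sub>N \<tau>\<^sup>N\<close>.\<close>

lemma faithful_on_insert:
  fixes t :: "'k::field_char_0 double_jordan"
  assumes faithful: "faithful_on (D.gen S)"
    and rel: "\<And>s. s \<in> S \<Longrightarrow> \<exists>\<alpha>\<in>D.gen S. \<exists>\<beta>\<in>D.gen S. t * s = \<alpha> * t + \<beta>"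
    and comm: "\<And>s. s \<in> S \<Longrightarrow> rho s * P = P * rho s"
    and tau: "P * rho t - rho t * P = \<tau>" "P * \<tau> = \<tau> * P" "\<tau> * \<tau>' = 1"
  shows "faithful_on (D.gen (insert t S))"
proof -
  \<comment> \<open>Commuting with \<open>P\<close> passes from \<open>S\<close> to the subalgebra
    it generates, so coefficients behave as constants for \<open>ad P\<close>.\<close>
  have L: "ad P (rho d) = 0" if "d \<in> D.gen S" for d
  proof -
    have "rho d * P = P * rho d" if "d \<in> D.gen S"
    proof -
      have "subalgebra scale_D {d. rho d * P = P * rho d}"
      proof (rule subalgebraI)
        fix a b assume ab: "a \<in> {d. rho d * P = P * rho d}" "b \<in> {d. rho d * P = P * rho d}"
        have "rho a * rho b * P = rho a * (P * rho b)" using ab by (simp add: mult.assoc)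
        also have "\<dots> = P * (rho a * rho b)" using ab by (simp flip: mult.assoc)
        finally show "a * b \<in> {d. rho d * P = P * rho d}" by (simp add: rho_mult)
      qed (auto simp: rho_one rho_add rho_scale distrib_left distrib_right lin_op.mult_scale_left
          lin_op.mult_scale_right)
      then have "D.gen S \<subseteq> {d. rho d * P = P * rho d}"
        using comm by (intro D.gen_minimal) auto
      then show ?thesis using that by blast
    qed
    then show ?thesis using that by (simp add: ad_def)
  qed
  have adt: "ad P (rho t) = \<tau>" "ad P (ad P (rho t)) = 0"
    using tau by (auto simp: ad_def)
  have tau_pow: "\<tau> ^ N * \<tau>' ^ N = 1" for N
    using tau(3) by (rule left_right_inverse_power)
  have zero: "(\<Sum>k<N. a k * t ^ k) = 0"
    if "\<And>k. a k \<in> D.gen S" "rho (\<Sum>k<N. a k * t ^ k) = 0" for a N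
    using that(2)
  proof (induction N)
    case (Suc N)
    have "0 = (ad P ^^ N) (\<Sum>k<Suc N. rho (a k) * rho t ^ k)"
      using Suc.prems by (simp only: rho_sum rho_mult rho_power ad_pow_zero)
    also have "\<dots> = (\<Sum>k<Suc N. rho (a k) * (ad P ^^ N) (rho t ^ k))"
      by (simp only: ad_pow_sum ad_pow_commuting_mult[OF L[OF that(1)]])
    also have "\<dots> = rho (a N) * (of_nat (fact N) * \<tau> ^ N)"
      by (simp add: ad_pow_power[OF adt(2)] adt(1))
    \<comment> \<open>The power of \<tau> stands to the right of the coefficient, so a right inverse
      is enough to remove it.\<close>
    finally have "0 = rho (a N) * (of_nat (fact N) * \<tau> ^ N) * \<tau>' ^ N"
      by simp
    also have "\<dots> = rho (a N) * of_nat (fact N) * (\<tau> ^ N * \<tau>' ^ N)"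
      by (simp only: mult.assoc)
    also have "\<dots> = rho (scale_D (of_nat (fact N)) (a N))"
      by (simp only: tau_pow rho_scale lin_op.scale_of_nat mult_1_right mult_of_nat_commute)
    finally have "scale_D (of_nat (fact N)) (a N) = 0"
      using faithful D.gen_scale[OF that(1)] unfolding faithful_on_def by metis
    \<comment> \<open>Characteristic 0: the factorial is a nonzero scalar.\<close>
    then have "a N = 0" by simp
    then show ?case using Suc by simp
  qed simp
  show ?thesis
    unfolding faithful_on_def
  proof (intro ballI impI)
    fix d assume "d \<in> D.gen (insert t S)" "rho d = 0"
    then show "d = 0"
      using D.gen_insert_left_polys[OF rel] zero unfolding D.left_polys_def by blast
  qed
qed

text \<open>An inverse brings no new independent variable, so instead of commutators denominators
  are cleared: a power of \<open>t\<close> carries each element into \<open>gen {t}\<close>, and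
  this power can be cancelled afterwards.\<close>

lemma faithful_on_insert_inverse:
  fixes t :: "'k::field_char_0 double_jordan"
  assumes faithful: "faithful_on (D.gen {t})" and inv: "t * t' = 1" "t' * t = 1"
  shows "faithful_on (D.gen {t', t})"
proof -
  have pow: "t ^ N * t' ^ N = 1 \<and> t' ^ N * t ^ N = 1" for N
    using inv by (simp add: left_right_inverse_power)
  let ?B = "{d. \<exists>N. t ^ N * d \<in> D.gen {t}}"
  have raise: "t ^ (M + N) * d \<in> D.gen {t}" if "t ^ N * d \<in> D.gen {t}" for M N d
    using D.gen_mult[OF D.gen_power[OF D.gen_base] that, of t M] by (simp add: power_add mult.assoc)
  have "subalgebra scale_D ?B"
  proof (rule subalgebraI)
    have "t ^ 0 * 1 \<in> D.gen {t}" by (simp add: D.gen_one)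
    then show "1 \<in> ?B" by blast
    fix a b assume "a \<in> ?B" "b \<in> ?B"
    then obtain N M where NM: "t ^ N * a \<in> D.gen {t}" "t ^ M * b \<in> D.gen {t}" by blast
    have "t ^ (M + N) * (a + b) \<in> D.gen {t}"
      using D.gen_add[OF raise[OF NM(1), of M] raise[OF NM(2), of N]]
      by (simp add: distrib_left add.commute)
    then show "a + b \<in> ?B" by blast
    \<comment> \<open>An algebra with one generator is commutative, so the second denominator can be
      moved past the first factor.\<close>
    have "t ^ N * a * t ^ M = t ^ M * (t ^ N * a)"
      by (rule D.gen_commute[OF NM(1)]) (simp add: power_commutes)
    then have "t ^ (M + N) * (a * b) = t ^ N * a * (t ^ M * b)"
      by (simp add: power_add mult.assoc[symmetric])
    also have "\<dots> \<in> D.gen {t}" by (rule D.gen_mult[OF NM])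
    finally show "a * b \<in> ?B" by blast
  next
    fix c a assume "a \<in> ?B"
    then show "scale_D c a \<in> ?B" by (auto simp: D.mult_scale_right intro: D.gen_scale)
  qed
  moreover have "t' \<in> ?B"
    using inv D.gen_one by (auto intro!: exI[of _ 1])
  moreover have "t \<in> ?B"
    using D.gen_base[of t "{t}"] by (auto intro!: exI[of _ 0])
  ultimately have sub: "D.gen {t', t} \<subseteq> ?B"
    by (intro D.gen_minimal) auto
  show ?thesis
    unfolding faithful_on_def
  proof (intro ballI impI)
    fix d assume d: "d \<in> D.gen {t', t}" "rho d = 0"
    then obtain N where N: "t ^ N * d \<in> D.gen {t}" using sub by blast
    have "rho (t ^ N * d) = 0" using d by (simp add: rho_mult)
    then have "t ^ N * d = 0" using N faithful unfolding faithful_on_def by blast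
    then have "t' ^ N * t ^ N * d = 0" by (simp add: mult.assoc)
    then show "d = 0" using pow by simp
  qed
qed

text \<open>The defining relations move generators past g only. Multiplying by the inverse on both
  sides yields the rule for its inverse.\<close>

lemma mult_inverse_commutation:
  fixes g g' t r :: "'a::ring_1"
  assumes "g * g' = 1" "g' * g = 1" "t * g = g * t + r"
  shows "t * g' = g' * t - g' * r * g'"
proof -
  have "t * g' = g' * g * t * g'" by (simp add: assms(2))
  also have "\<dots> = g' * (t * g - r) * g'" by (simp add: assms(3) mult.assoc)
  also have "\<dots> = g' * t * (g * g') - g' * r * g'"
    by (simp add: left_diff_distrib right_diff_distrib mult.assoc)
  finally show ?thesis by (simp add: assms(1))
qed

lemma ore_relI:
  "t * s = \<alpha> * t
      + \<beta> \<Longrightarrow> \<alpha> \<in> B \<Longrightarrow> \<beta> \<in> B \<Longrightarrow> \<exists>\<alpha>\<in>B. \<exists>\<beta>\<in>B. t * s = \<alpha> * t + \<beta>"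
  by blast

text \<open>The generators are adjoined in the order g, its inverse, x, \<zeta>, y, u, v. Each new
  one moves past the earlier ones with coefficients in the algebra already built. Except for the
  inverse of g, there is an operator P that commutes with the earlier generators and has an
  invertible commutator with the new one.\<close>

theorem rho_faithful:
  fixes d :: "'k::field_char_0 double_jordan"
  assumes "rho d = 0"
  shows "d = 0"
proof -
  let ?u = "gen_D Gen_u :: 'k double_jordan" and ?v = "gen_D Gen_v :: 'k double_jordan"
    and ?z = "gen_D Gen_zeta :: 'k double_jordan" and ?g = "gen_D Gen_g :: 'k double_jordan"
    and ?h = "gen_D Gen_ginv :: 'k double_jordan" and ?x = "gen_D Gen_x :: 'k double_jordan"
    and ?y = "gen_D Gen_y :: 'k double_jordan"
  note rels = gen_D_relations[where ?'k = 'k]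
  note ginv = mult_inverse_commutation[OF rels(1,2)]
  note mem = D.gen_intros D.gen_base
  note rho_simps = rho_gen_D rho_expand euler_scalar rho_collect half_collect
  \<comment> \<open>With no generators only scalar multiples of 1 remain.\<close>
  have "faithful_on (D.gen ({} :: 'k double_jordan set))"
    unfolding faithful_on_def
    by (auto elim!: D.gen_empty simp: rho_scale rho_one)
  then have "faithful_on (D.gen {?g})"
  proof (rule faithful_on_insert)
    \<comment> \<open>P is d/dg, written in the coordinate h with \<open>h ^ 2\<close> equal to
      g.\<close>
    show "scale_op (1/2) (mult_op (vh' ^ 2) * Eh) * rho ?g - rho ?g * scale_op (1/2) (mult_op (vh' ^ 2) * Eh) = 1"
      by (rule lin_op_eqI, simp add: rho_simps)
  qed auto
  then have "faithful_on (D.gen {?h, ?g})"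
    by (rule faithful_on_insert_inverse) (rule rels)+
  then have "faithful_on (D.gen {?x, ?h, ?g})"
  proof (rule faithful_on_insert)
    \<comment> \<open>P is d/dx.\<close>
    show "mult_op vx' * Ex * rho ?x - rho ?x * (mult_op vx' * Ex) = 1"
      by (rule lin_op_eqI, simp add: rho_simps)
    show "rho s * (mult_op vx' * Ex) = mult_op vx' * Ex * rho s" if "s \<in> {?h, ?g}" for s
      using that by (auto intro!: lin_op_eqI simp: rho_simps)
    have xg: "?x * ?g = ?g * ?x + 0" by (simp add: rels)
    have xh: "?x * ?h = ?h * ?x + 0" using ginv[OF xg] by simp
    show "\<exists>\<alpha>\<in>D.gen {?h, ?g}. \<exists>\<beta>\<in>D.gen {?h, ?g}. ?x * s
        = \<alpha> * ?x + \<beta>"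
      if s: "s \<in> {?h, ?g}" for s
      using s
    proof (elim insertE emptyE)
      show ?thesis if "s = ?h" unfolding that by (rule ore_relI[OF xh]) (intro mem; simp)+
      show ?thesis if "s = ?g" unfolding that by (rule ore_relI[OF xg]) (intro mem; simp)+
    qed
  qed auto
  then have "faithful_on (D.gen {?z, ?x, ?h, ?g})"
  proof (rule faithful_on_insert)
    \<comment> \<open>So far only multiplications are present, while \<zeta> differentiates in x;
      hence P is multiplication by x.\<close>
    show "mult_op vx * rho ?z - rho ?z * mult_op vx = - mult_op vx"
      by (rule lin_op_eqI, simp add: rho_simps)
    show "- mult_op vx * - mult_op vx' = (1 :: (_, 'k) lin_op)"
      by (rule lin_op_eqI, simp add: rho_simps)
    show "rho s * mult_op vx = mult_op vx * rho s" if "s \<in> {?x, ?h, ?g}" for s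
      using that by (auto intro!: lin_op_eqI simp: rho_simps)
    have zg: "?z * ?g = ?g * ?z + 0" by (simp add: rels)
    have zh: "?z * ?h = ?h * ?z + 0" using ginv[OF zg] by simp
    have zx: "?z * ?x = ?x * ?z + ?x" by (simp add: rels)
    show "\<exists>\<alpha>\<in>D.gen {?x, ?h, ?g}. \<exists>\<beta>\<in>D.gen {?x, ?h, ?g}. ?z * s = \<alpha> * ?z + \<beta>"
      if s: "s \<in> {?x, ?h, ?g}" for s
      using s
    proof (elim insertE emptyE)
      show ?thesis if "s = ?x" unfolding that by (rule ore_relI[OF zx]) (intro mem; simp)+
      show ?thesis if "s = ?h" unfolding that by (rule ore_relI[OF zh]) (intro mem; simp)+
      show ?thesis if "s = ?g" unfolding that by (rule ore_relI[OF zg]) (intro mem; simp)+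
    qed
  qed (auto intro!: lin_op_eqI)
  then have "faithful_on (D.gen {?y, ?z, ?x, ?h, ?g})"
  proof (rule faithful_on_insert)
    \<comment> \<open>Among the operators so far only y differentiates in h; hence P is
      multiplication by h.\<close>
    show "mult_op vh * rho ?y - rho ?y * mult_op vh = scale_op (1/2) (mult_op (vx * vh))"
      by (rule lin_op_eqI, simp add: rho_simps)
    show "mult_op vh * scale_op (1/2) (mult_op (vx * vh)) =
        scale_op (1/2) (mult_op (vx * vh)) * (mult_op vh :: (_, 'k) lin_op)"
      by (rule lin_op_eqI, simp add: rho_simps)
    show "scale_op (1/2) (mult_op (vx * vh)) * scale_op 2 (mult_op (vx' * vh')) = (1 :: (_, 'k) lin_op)"
      by (rule lin_op_eqI, simp add: rho_simps scalar_numeral)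
    show "rho s * mult_op vh = mult_op vh * rho s" if "s \<in> {?z, ?x, ?h, ?g}" for s
      using that by (auto intro!: lin_op_eqI simp: rho_simps)
    have yx: "?y * ?x = ?x * ?y + - scale_D (1/2) (?x ^ 2)" by (simp add: rels)
    have yg: "?y * ?g = ?g * ?y + - (?x * ?g)" by (simp add: rels)
    \<comment> \<open>Here the twist of the Ore extension is nontrivial: it shifts \<zeta> by a
      constant.\<close>
    have yz: "?y * ?z = (?z - 1) * ?y + 0" by (simp add: rels algebra_simps)
    have yh: "?y * ?h = ?h * ?y + - (?h * - (?x * ?g) * ?h)" using ginv[OF yg] by simp
    show "\<exists>\<alpha>\<in>D.gen {?z, ?x, ?h, ?g}. \<exists>\<beta>\<in>D.gen {?z, ?x, ?h, ?g}. ?y * s = \<alpha> * ?y + \<beta>"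
      if s: "s \<in> {?z, ?x, ?h, ?g}" for s
      using s
    proof (elim insertE emptyE)
      show ?thesis if "s = ?z" unfolding that by (rule ore_relI[OF yz]) (intro mem; simp)+
      show ?thesis if "s = ?x" unfolding that by (rule ore_relI[OF yx]) (intro mem; simp)+
      show ?thesis if "s = ?h" unfolding that by (rule ore_relI[OF yh]) (intro mem; simp)+
      show ?thesis if "s = ?g" unfolding that by (rule ore_relI[OF yg]) (intro mem; simp)+
    qed
  qed
  then have "faithful_on (D.gen {?u, ?y, ?z, ?x, ?h, ?g})"
  proof (rule faithful_on_insert)
    \<comment> \<open>P is d/da: u is the first operator that contains a, and it is of degree one in
      it.\<close>
    show "mult_op va' * Ea * rho ?u - rho ?u * (mult_op va' * Ea) = mult_op (vx' * vh)"
      by (rule lin_op_eqI, simp add: rho_simps)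
    show "mult_op va' * Ea * mult_op (vx' * vh)
        = mult_op (vx' * vh) * (mult_op va' * Ea :: (_, 'k) lin_op)"
      by (rule lin_op_eqI, simp add: rho_simps)
    show "mult_op (vx' * vh) * mult_op (vx * vh') = (1 :: (_, 'k) lin_op)"
      by (rule lin_op_eqI, simp add: rho_simps)
    show "rho s * (mult_op va' * Ea) = mult_op va' * Ea * rho s" if "s \<in> {?y, ?z, ?x, ?h, ?g}" for s
      using that by (auto intro!: lin_op_eqI simp: rho_simps)
    have ux: "?u * ?x = ?x * ?u + 0" by (simp add: rels)
    have ug: "?u * ?g = ?g * ?u + 0" by (simp add: rels)
    have uz: "?u * ?z = (?z + 1) * ?u + 0" by (simp add: rels algebra_simps)
    have uh: "?u * ?h = ?h * ?u + 0" using ginv[OF ug] by simp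
    have uy: "?u * ?y = ?y * ?u + (1 - ?g)" by (simp add: rels)
    show "\<exists>\<alpha>\<in>D.gen {?y, ?z, ?x, ?h, ?g}. \<exists>\<beta>\<in>D.gen {?y, ?z, ?x, ?h, ?g}. ?u * s = \<alpha> * ?u + \<beta>"
      if s: "s \<in> {?y, ?z, ?x, ?h, ?g}" for s
      using s
    proof (elim insertE emptyE)
      show ?thesis if "s = ?y" unfolding that by (rule ore_relI[OF uy]) (intro mem; simp)+
      show ?thesis if "s = ?z" unfolding that by (rule ore_relI[OF uz]) (intro mem; simp)+
      show ?thesis if "s = ?x" unfolding that by (rule ore_relI[OF ux]) (intro mem; simp)+
      show ?thesis if "s = ?h" unfolding that by (rule ore_relI[OF uh]) (intro mem; simp)+
      show ?thesis if "s = ?g" unfolding that by (rule ore_relI[OF ug]) (intro mem; simp)+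
    qed
  qed
  then have "faithful_on (D.gen {?v, ?u, ?y, ?z, ?x, ?h, ?g})"
  proof (rule faithful_on_insert)
    \<comment> \<open>P is d/db: b occurs in v alone, and to degree one.\<close>
    show "mult_op vb' * Eb * rho ?v - rho ?v * (mult_op vb' * Eb) = mult_op (vx' * vh)"
      by (rule lin_op_eqI, simp add: rho_simps)
    show "mult_op vb' * Eb * mult_op (vx' * vh)
        = mult_op (vx' * vh) * (mult_op vb' * Eb :: (_, 'k) lin_op)"
      by (rule lin_op_eqI, simp add: rho_simps)
    show "mult_op (vx' * vh) * mult_op (vx * vh') = (1 :: (_, 'k) lin_op)"
      by (rule lin_op_eqI, simp add: rho_simps)
    show "rho s * (mult_op vb' * Eb) = mult_op vb' * Eb * rho s"
        if "s \<in> {?u, ?y, ?z, ?x, ?h, ?g}" for s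
      using that by (auto intro!: lin_op_eqI simp: rho_simps)
    have vu: "?v * ?u = ?u * ?v + - scale_D (1/2) (?u ^ 2)" by (simp add: rels)
    have vx: "?v * ?x = ?x * ?v + ((1 - ?g) + ?x * ?u)" by (simp add: rels)
    have vg: "?v * ?g = ?g * ?v + ?g * ?u" by (simp add: rels)
    have vz: "?v * ?z = (?z + 1) * ?v + 0" by (simp add: rels algebra_simps)
    have vh: "?v * ?h = ?h * ?v + - (?h * (?g * ?u) * ?h)" using ginv[OF vg] by simp
    have vy: "?v * ?y = ?y * ?v + (?y * ?u - ?g * ?z)" by (simp add: rels)
    show "\<exists>\<alpha>\<in>D.gen {?u, ?y, ?z, ?x, ?h, ?g}. \<exists>\<beta>\<in>D.gen {?u, ?y, ?z, ?x, ?h, ?g}. ?v * s = \<alpha> * ?v + \<beta>"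
      if s: "s \<in> {?u, ?y, ?z, ?x, ?h, ?g}" for s
      using s
    proof (elim insertE emptyE)
      show ?thesis if "s = ?u" unfolding that by (rule ore_relI[OF vu]) (intro mem; simp)+
      show ?thesis if "s = ?y" unfolding that by (rule ore_relI[OF vy]) (intro mem; simp)+
      show ?thesis if "s = ?z" unfolding that by (rule ore_relI[OF vz]) (intro mem; simp)+
      show ?thesis if "s = ?x" unfolding that by (rule ore_relI[OF vx]) (intro mem; simp)+
      show ?thesis if "s = ?h" unfolding that by (rule ore_relI[OF vh]) (intro mem; simp)+
      show ?thesis if "s = ?g" unfolding that by (rule ore_relI[OF vg]) (intro mem; simp)+
    qed
  qed
  moreover have "range gen_D \<subseteq> {?v, ?u, ?y, ?z, ?x, ?h, ?g}"
  proof
    fix d assume "d \<in> range (gen_D :: _ \<Rightarrow> 'k double_jordan)"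
    then obtain i where "d = gen_D i" by blast
    then show "d \<in> {?v, ?u, ?y, ?z, ?x, ?h, ?g}" by (cases i) auto
  qed
  then have "d \<in> D.gen {?v, ?u, ?y, ?z, ?x, ?h, ?g}"
    using hull_mono gen_range_gen_D by blast
  ultimately show ?thesis using assms unfolding faithful_on_def by blast
qed

section \<open>The center\<close>

lemma rho_inject: "rho a = rho b \<Longrightarrow> a = (b :: 'k::field_char_0 double_jordan)"
  using rho_faithful[of "a - b"] by (simp add: rho_diff)

lemma rho_q: "rho (q_D :: 'k::field_char_0 double_jordan) = mult_op (va * vh)"
  by (rule lin_op_eqI) (simp add: q_D_def Let_def rho_add rho_mult rho_scale rho_one rho_gen_D
      rho_expand rho_collect scalar_numeral)

text \<open>The first-order parts of \<open>x * v\<close>, \<open>u * y\<close> and the \<zeta> term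
  cancel, leaving a multiplication operator.\<close>

lemma rho_s: "rho (s_D :: 'k::field_char_0 double_jordan) = mult_op (vb * vh)"
  by (rule lin_op_eqI, simp add: s_D_def Let_def rho_add rho_diff rho_mult rho_scale rho_one rho_gen_D
      scalar_numeral rho_expand euler_scalar; (simp add: rho_collect)?; (simp add: half_collect)?)

lemma rho_z: "rho (z_D :: 'k::field_char_0 double_jordan) = mult_op (va ^ 2)"
  and rho_omega: "rho (omega_D :: 'k double_jordan) = mult_op (va * vb)"
  and rho_theta: "rho (theta_D :: 'k double_jordan) = mult_op (vb ^ 2)"
  by (rule lin_op_eqI, simp add: z_D_def omega_D_def theta_D_def rho_mult rho_power rho_q rho_s
      rho_gen_D power2_eq_square rho_collect; fail)+

section \<open>The three elements are central\<close>

lemma subalgebra_gen_D_UNIV: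
  assumes "subalgebra scale_D B" "\<And>i. gen_D i \<in> B"
  shows "d \<in> (B :: 'k::field double_jordan set)"
  using D.gen_minimal[of "range gen_D" B] gen_range_gen_D[of d] assms by blast

lemma rho_commutes:
  fixes d :: "'k::field_char_0 double_jordan"
  assumes "\<And>i. rho_gen i * T = T * rho_gen i"
  shows "rho d * T = T * rho d"
proof -
  have "d \<in> {d. rho d * T = T * rho d}"
  proof (rule subalgebra_gen_D_UNIV, rule subalgebraI)
    fix a b :: "'k double_jordan"
    assume ab: "a \<in> {d. rho d * T = T * rho d}" "b \<in> {d. rho d * T = T * rho d}"
    have "rho a * rho b * T = rho a * (T * rho b)" using ab by (simp add: mult.assoc)
    also have "\<dots> = T * (rho a * rho b)" using ab by (simp flip: mult.assoc)
    finally show "a * b \<in> {d. rho d * T = T * rho d}" by (simp add: rho_mult)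
  qed (auto simp: rho_one rho_add rho_scale rho_gen_D distrib_left distrib_right
      lin_op.mult_scale_left lin_op.mult_scale_right assms)
  then show ?thesis by simp
qed

text \<open>No generator differentiates in a or b, so the action is linear over polynomials in
  them.\<close>

lemma rho_commutes_ab:
  "rho d * mult_op va = mult_op va * rho (d :: 'k::field_char_0 double_jordan)"
  "rho d * mult_op vb = mult_op vb * rho d"
proof -
  show "rho d * mult_op va = mult_op va * rho d"
  proof (rule rho_commutes)
    show "rho_gen i * mult_op va = mult_op va * (rho_gen i :: (_, 'k) lin_op)" for i
      by (cases i) (auto intro!: lin_op_eqI simp: rho_expand algebra_simps)
  qed
  show "rho d * mult_op vb = mult_op vb * rho d"
  proof (rule rho_commutes)
    show "rho_gen i * mult_op vb = mult_op vb * (rho_gen i :: (_, 'k) lin_op)" for i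
      by (cases i) (auto intro!: lin_op_eqI simp: rho_expand algebra_simps)
  qed
qed

lemma subalgebra_center: "subalgebra scale_D (center :: 'k::field double_jordan set)"
proof (rule subalgebraI)
  fix a b :: "'k double_jordan"
  assume "a \<in> center" "b \<in> center"
  then have a: "a * d = d * a" and b: "b * d = d * b" for d
    by (simp_all add: center_def)
  have "a * b * d = d * (a * b)" for d
    by (simp only: mult.assoc b[of d]) (simp only: mult.assoc[symmetric] a[of d])
  then show "a * b \<in> center" by (simp add: center_def)
qed (auto simp: center_def distrib_left distrib_right D.mult_scale_left D.mult_scale_right)

lemma gen_subset_center: "D.gen {z_D, omega_D, theta_D} \<subseteq> (center :: 'k::field_char_0 double_jordan set)"
proof (rule D.gen_minimal)
  have comm: "mult_op (v * w) * rho d = rho d * mult_op (v * w)"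
    if "rho d * mult_op v = mult_op v * rho d" "rho d * mult_op w = mult_op w * rho d"
    for v w and d :: "'k double_jordan"
  proof -
    have "mult_op v * (mult_op w * rho d) = mult_op v * rho d * mult_op w"
      by (simp only: that(2)[symmetric] mult.assoc)
    then show ?thesis by (simp only: that(1)[symmetric] mult_op_mult mult.assoc)
  qed
  have "z_D * d = d * z_D" "omega_D * d = d * omega_D" "theta_D * d = d * theta_D"
    for d :: "'k double_jordan"
    by (rule rho_inject, simp only: rho_mult rho_z rho_omega rho_theta power2_eq_square,
        rule comm; rule rho_commutes_ab)+
  then show "{z_D, omega_D, theta_D} \<subseteq> (center :: 'k double_jordan set)"
    by (auto simp: center_def)
qed (rule subalgebra_center)

text \<open>A subspace preserved by \<open>rho\<close>; on it \<open>a\<close>, \<open>b\<close> and \<open>h\<close> enter only through \<open>a h\<close>, \<open>b h\<close>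
  and \<open>h\<^sup>\<plusminus>\<^sup>2\<close>.\<close>

definition even_laurent :: "'k::field laurent set" where
  "even_laurent = {w. \<forall>(i, j, m, n)\<in>Poly_Mapping.keys w. 0 \<le> i \<and> 0 \<le> j \<and> even (i + j + n)}"

lemma even_laurent_add: "v \<in> even_laurent \<Longrightarrow> w \<in> even_laurent \<Longrightarrow> v + w \<in> even_laurent"
  unfolding even_laurent_def using keys_add[of v w] by blast

lemma even_laurent_uminus: "w \<in> even_laurent \<Longrightarrow> - w \<in> even_laurent"
  unfolding even_laurent_def by (auto simp: in_keys_iff)

lemma even_laurent_diff: "v \<in> even_laurent \<Longrightarrow> w \<in> even_laurent \<Longrightarrow> v - w \<in> even_laurent"
  using even_laurent_add[of v "- w"] even_laurent_uminus[of w] by simp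

lemma even_laurent_mult:
  assumes "v \<in> even_laurent" "w \<in> even_laurent" shows "v * w \<in> even_laurent"
  unfolding even_laurent_def
proof clarify
  fix i j m n assume "(i, j, m, n) \<in> Poly_Mapping.keys (v * w)"
  then obtain p q where "p \<in> Poly_Mapping.keys v" "q \<in> Poly_Mapping.keys w" "(i, j, m, n)
      = p + q"
    using keys_mult[of v w] by blast
  then show "0 \<le> i \<and> 0 \<le> j \<and> even (i + j + n)"
    using assms unfolding even_laurent_def by (cases p; cases q) fastforce
qed

lemma even_laurent_single:
  "0 \<le> i \<Longrightarrow> 0 \<le> j \<Longrightarrow> even (i + j
      + n) \<Longrightarrow> Poly_Mapping.single (i, j, m, n) c \<in> even_laurent"
  by (auto simp: even_laurent_def)

lemma even_laurent_scalar: "scalar c \<in> even_laurent"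
  using even_laurent_single[of 0 0 0 0 c] by (simp add: scalar_def zero_prod_def)

lemma even_laurent_weight_op: "w \<in> even_laurent \<Longrightarrow> app (weight_op \<psi>) w \<in> even_laurent"
  by (auto simp: even_laurent_def in_keys_iff lookup_weight_op)

lemma even_laurent_vars:
  "vx \<in> even_laurent" "vx' \<in> even_laurent" "vh ^ 2 \<in> even_laurent" "vh' ^ 2 \<in> even_laurent"
  "va * vh \<in> even_laurent" "vb * vh \<in> even_laurent"
  by (simp_all add: va_def vb_def vx_def vh_def vx'_def vh'_def power2_eq_square mon_mult)
    (simp_all add: mon_def even_laurent_single)

lemma even_laurent_numeral: "1 \<in> even_laurent" "numeral k \<in> even_laurent"
  using even_laurent_scalar[of 1] even_laurent_scalar[of "numeral k"]
  by (simp_all add: scalar_one scalar_numeral)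

text \<open>The generators act through \<open>vx\<close>, \<open>vx'\<close>, even powers of h,
  \<open>va * vh\<close>, \<open>vb * vh\<close>, scalars and Euler operators; the latter never
  enlarge a support.\<close>

lemma rho_even_laurent:
  fixes d :: "'k::field_char_0 double_jordan"
  shows "w \<in> even_laurent \<Longrightarrow> app (rho d) w \<in> even_laurent"
proof -
  note intros = even_laurent_add even_laurent_diff even_laurent_uminus even_laurent_mult
    even_laurent_scalar even_laurent_vars even_laurent_numeral even_laurent_weight_op
  have "d \<in> {d. \<forall>w\<in>even_laurent. app (rho d) w \<in> even_laurent}"
  proof (rule subalgebra_gen_D_UNIV, rule subalgebraI)
    show "gen_D i \<in> {d :: 'k double_jordan. \<forall>w\<in>even_laurent. app (rho d) w \<in> even_laurent}" for i
      by (cases i) (auto simp: rho_gen_D u_poly_def Ex_def Eh_def intro!: intros)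
  qed (auto simp: rho_one rho_add rho_mult rho_scale intro!: intros)
  then show "w \<in> even_laurent \<Longrightarrow> app (rho d) w \<in> even_laurent" by blast
qed

section \<open>Central elements act by multiplication\<close>

lemma mon_power: "mon i j m n ^ k = mon (int k * i) (int k * j) (int k * m) (int k * n)"
  by (induction k) (simp_all add: mon_zero mon_mult algebra_simps)

lemma mon_factor:
  "mon i j m n = (if i \<ge> 0 then va ^ nat i else va' ^ nat (- i)) * (if j \<ge> 0 then vb ^ nat j else vb' ^ nat (- j))
     * (if m \<ge> 0 then vx ^ nat m else vx' ^ nat (- m)) * (if n \<ge> 0 then vh ^ nat n else vh' ^ nat (- n))"
  by (simp add: va_def va'_def vb_def vb'_def vx_def vx'_def vh_def vh'_def mon_power mon_mult)

lemma commute_inverse: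
  fixes T p p' :: "'a::ring_1"
  assumes "T * p = p * T" "p * p' = 1" "p' * p = 1"
  shows "T * p' = p' * T"
  using mult_inverse_commutation[of p p' T 0] assms by simp

text \<open>The commutant of \<open>rho c\<close> contains all generators as well as a and b. From
  these every Laurent monomial and both Euler operators \<open>Ex\<close>, \<open>Eh\<close> are
  recovered, so \<open>rho c\<close> is multiplication by its value at 1, and this value is free of
  x and h.\<close>

lemma center_rho:
  fixes c :: "'k::field_char_0 double_jordan"
  assumes c: "c \<in> center"
  defines "l \<equiv> app (rho c) 1"
  shows "rho c = mult_op l"
    and "\<And>i j m n. (i, j, m, n) \<in> Poly_Mapping.keys l \<Longrightarrow>
      0 \<le> i \<and> 0 \<le> j \<and> m = 0 \<and> n = 0 \<and> even (i + j)"
proof -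
  define T where "T = rho c"
  let ?C = "{S. T * S = S * T}"
  have mult: "S * S' \<in> ?C" if "S \<in> ?C" "S' \<in> ?C" for S S'
  proof -
    have "T * (S * S') = S * T * S'" using that by (simp flip: mult.assoc)
    then show ?thesis using that by (simp add: mult.assoc)
  qed
  have add: "S + S' \<in> ?C" if "S \<in> ?C" "S' \<in> ?C" for S S'
    using that by (simp add: distrib_left distrib_right)
  have diff: "S - S' \<in> ?C" if "S \<in> ?C" "S' \<in> ?C" for S S'
    using that by (simp add: left_diff_distrib right_diff_distrib)
  have scl: "scale_op k S \<in> ?C" if "S \<in> ?C" for S k
    using that by (simp add: lin_op.mult_scale_left lin_op.mult_scale_right)
  have one: "1 \<in> ?C" by simp
  have gens: "rho_gen i \<in> ?C" for i
  proof -
    have "rho (c * gen_D i) = rho (gen_D i * c)" using c by (simp add: center_def)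
    then show ?thesis by (simp add: rho_mult rho_gen_D T_def)
  qed
  have inv: "mult_op p' \<in> ?C" if "mult_op p \<in> ?C" "p * p' = 1" for p p'
    using that commute_inverse[of T "mult_op p" "mult_op p'"]
    by (simp add: mult_op_one mult.commute flip: mult_op_mult)
  have a: "mult_op va \<in> ?C" "mult_op vb \<in> ?C"
    using rho_commutes_ab by (auto simp: T_def)
  have a': "mult_op va' \<in> ?C" "mult_op vb' \<in> ?C"
    using inv[OF a(1) va_inverse] inv[OF a(2) vb_inverse] .
  have x: "mult_op vx \<in> ?C" using gens[of Gen_x] by simp
  have x': "mult_op vx' \<in> ?C" by (rule inv[OF x vx_inverse])
  have Ex: "Ex \<in> ?C" using gens[of Gen_zeta] by simp
  \<comment> \<open>The formula for y, solved for \<open>Eh\<close>.\<close>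
  have Eh_eq: "Eh = scale_op (- 2) (mult_op vx' * rho_gen Gen_y) - (Ex :: (_, 'k) lin_op)"
    by (rule lin_op_eqI) (simp add: rho_expand euler_scalar rho_collect scalar_minus scalar_numeral)
  have Eh: "Eh \<in> ?C" unfolding Eh_eq by (intro diff scl mult x' gens Ex)
  \<comment> \<open>The formula for u, solved for h; this is where a has to be inverted.\<close>
  have h_eq: "mult_op vh
      = mult_op va' * (mult_op vx * rho_gen Gen_u + scale_op 2 (1 + rho_gen Gen_g) :: (_, 'k) lin_op)"
    by (rule lin_op_eqI) (simp add: rho_expand rho_collect scalar_numeral)
  have h: "mult_op vh \<in> ?C" unfolding h_eq by (intro mult add scl a' x gens one)
  have h': "mult_op vh' \<in> ?C" by (rule inv[OF h vh_inverse])
  have pow: "mult_op (p ^ k) \<in> ?C" if "mult_op p \<in> ?C" for p k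
    using that by (induction k) (simp_all add: mult_op_one mult_op_mult mult[simplified])
  have mon: "mult_op (mon i j m n) \<in> ?C" for i j m n
    unfolding mon_factor mult_op_mult
    by (intro mult) (auto intro: pow[OF a(1), simplified] pow[OF a(2), simplified] pow[OF a'(1), simplified]
        pow[OF a'(2), simplified] pow[OF x, simplified] pow[OF x', simplified] pow[OF h, simplified]
        pow[OF h', simplified])
  have all: "mult_op w \<in> ?C" for w
  proof -
    have "Poly_Mapping.single p k
        = scalar k * mon (fst p) (fst (snd p)) (fst (snd (snd p))) (snd (snd (snd p)))"
      for p and k :: 'k
      by (simp add: scalar_def mon_def mult_single)
    then have single: "mult_op (Poly_Mapping.single p k) \<in> ?C" for p k
      using scl[OF mon] by (simp add: mult_op_scalar)
    have "mult_op (\<Sum>p\<in>A. Poly_Mapping.single p (k p)) \<in> ?C" for A k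
      by (induction A rule: infinite_finite_induct)
        (use single add in \<open>simp_all add: mult_op_add mult_op_zero\<close>)
    then show ?thesis
      by (subst poly_mapping_sum_single[of w])
  qed
  \<comment> \<open>Evaluate the commutation of \<open>T\<close> with multiplication by
    \<open>w\<close> at the constant 1.\<close>
  have "app T w = w * l" for w
  proof -
    have "T * mult_op w = mult_op w * T" using all[of w] by blast
    from arg_cong[OF this, of "\<lambda>S. app S 1"] show ?thesis by (simp add: l_def T_def)
  qed
  then show "rho c = mult_op l"
    by (intro lin_op_eqI) (simp add: T_def mult.commute)
  fix i j m n assume p: "(i, j, m, n) \<in> Poly_Mapping.keys l"
  \<comment> \<open>Euler operators kill 1 and commute with \<open>T\<close>, hence kill
    \<open>l\<close>. In characteristic 0 this forces the exponents of x and h to be zero.\<close>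
  have "app Ex l = 0" "app Eh l = 0"
  proof -
    have "T * Ex = Ex * T" "T * Eh = Eh * T" using Ex Eh by blast+
    from this[THEN arg_cong, of "\<lambda>S. app S 1"] show "app Ex l = 0" "app Eh l = 0"
      by (simp_all add: euler_one l_def T_def)
  qed
  then have "Poly_Mapping.lookup (app Ex l) (i, j, m, n)
      = 0" "Poly_Mapping.lookup (app Eh l) (i, j, m, n) = 0"
    by simp_all
  then have "m = 0" "n = 0"
    using p by (simp_all add: Ex_def Eh_def lookup_weight_op in_keys_iff)
  \<comment> \<open>The constant 1 is even, so its image is; this gives nonnegative exponents and
    the parity condition.\<close>
  moreover have "l \<in> even_laurent"
    unfolding l_def by (intro rho_even_laurent even_laurent_numeral)
  ultimately show "0 \<le> i \<and> 0 \<le> j \<and> m = 0 \<and> n = 0 \<and> even (i + j)"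
    using p unfolding even_laurent_def by fastforce
qed

section \<open>The quadric cone\<close>

interpretation cone: unital_algebra scale_cone
proof
  fix c d :: "'a::field" and a b :: "'a cone_ring"
  show "scale_cone (c + d) a = scale_cone c a + scale_cone d a"
    by transfer (simp add: scalar_add distrib_right ideal_cong_refl)
  show "scale_cone c (a + b) = scale_cone c a + scale_cone c b"
    by transfer (simp add: distrib_left ideal_cong_refl)
  show "scale_cone c (scale_cone d a) = scale_cone (c * d) a"
    by transfer (simp add: scalar_mult mult.assoc ideal_cong_refl)
  show "scale_cone 1 a = a"
    by transfer (simp add: scalar_one ideal_cong_refl)
  show "scale_cone c a * b = scale_cone c (a * b)"
    by transfer (simp add: mult.assoc ideal_cong_refl)
  show "a * scale_cone c b = scale_cone c (a * b)"
    by transfer (simp add: ideal_cong_refl scalar_commute flip: mult.assoc)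
qed

section \<open>Monomials in the cone ring\<close>

definition monomial_exp :: "nat \<Rightarrow> nat \<Rightarrow> nat \<Rightarrow> cone_var \<Rightarrow>\<^sub>0 nat" where
  "monomial_exp i j k = Poly_Mapping.single Var_X i + Poly_Mapping.single Var_Y j
      + Poly_Mapping.single Var_Z k"

definition cone_gen :: "cone_var \<Rightarrow> 'k::field cone_ring" where
  "cone_gen i = abs_cone_ring (poly_var i)"

definition cone_monomial :: "(cone_var \<Rightarrow>\<^sub>0 nat) \<Rightarrow> 'k::field cone_ring" where
  "cone_monomial m = cone_gen Var_X ^ Poly_Mapping.lookup m Var_X
     * cone_gen Var_Y ^ Poly_Mapping.lookup m Var_Y * cone_gen Var_Z ^ Poly_Mapping.lookup m Var_Z"

lemma lookup_monomial_exp [simp]: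
  "Poly_Mapping.lookup (monomial_exp i j k) Var_X = i"
  "Poly_Mapping.lookup (monomial_exp i j k) Var_Y = j"
  "Poly_Mapping.lookup (monomial_exp i j k) Var_Z = k"
  by (simp_all add: monomial_exp_def lookup_add lookup_single)

lemma monomial_exp_lookup:
  "monomial_exp (Poly_Mapping.lookup m Var_X) (Poly_Mapping.lookup m Var_Y) (Poly_Mapping.lookup m Var_Z) = m"
proof (rule poly_mapping_eqI)
  show "Poly_Mapping.lookup (monomial_exp (Poly_Mapping.lookup m Var_X) (Poly_Mapping.lookup m Var_Y)
      (Poly_Mapping.lookup m Var_Z)) i = Poly_Mapping.lookup m i" for i
    by (cases i) simp_all
qed

lemma abs_cone_power: "abs_cone_ring p ^ n = abs_cone_ring (p ^ n)"
  by (induction n) (simp_all add: one_cone_ring_def times_cone_ring.abs_eq)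

lemma poly_var_power: "poly_var i ^ n = Poly_Mapping.single (Poly_Mapping.single i n) 1"
  by (induction n) (simp_all add: poly_var_def mult_single flip: single_add)

lemma abs_cone_single: "abs_cone_ring (Poly_Mapping.single m c) = scale_cone c (cone_monomial m)"
proof -
  have "Poly_Mapping.single m c = scalar c * (poly_var Var_X ^ Poly_Mapping.lookup m Var_X
     * poly_var Var_Y ^ Poly_Mapping.lookup m Var_Y * poly_var Var_Z ^ Poly_Mapping.lookup m Var_Z)"
    by (simp add: poly_var_power mult_single scalar_def monomial_exp_lookup flip: monomial_exp_def)
  then show ?thesis
    by (simp add: cone_monomial_def cone_gen_def abs_cone_power times_cone_ring.abs_eq scale_cone.abs_eq)
qed

lemma abs_cone_ring_eq: "abs_cone_ring p = cone.alg_ext cone_monomial p"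
proof -
  have "abs_cone_ring (\<Sum>m\<in>A. Poly_Mapping.single m (c m))
      = (\<Sum>m\<in>A. scale_cone (c m) (cone_monomial m))" for A c
    by (induction A rule: infinite_finite_induct)
      (simp_all add: abs_cone_single zero_cone_ring_def flip: plus_cone_ring.abs_eq)
  from this[of "Poly_Mapping.lookup p" "Poly_Mapping.keys p"] show ?thesis
    by (simp only: poly_mapping_sum_single[symmetric] cone.alg_ext_def)
qed

lemma cone_gen_relation: "cone_gen Var_X * cone_gen Var_Z = cone_gen Var_Y ^ 2"
proof -
  have "ideal_cong cone_rels (poly_var Var_X * poly_var Var_Z) (poly_var Var_Y ^ 2)"
    by (rule ideal_cong_rel) (simp add: cone_rels_def)
  then show ?thesis
    by (simp add: cone_gen_def abs_cone_power times_cone_ring.abs_eq cone_ring.abs_eq_iff)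
qed

text \<open>\<open>X \<mapsto> a\<^sup>2\<close>, \<open>Y \<mapsto> a b\<close>, \<open>Z \<mapsto> b\<^sup>2\<close> on monomials, and its section onto the monomials in which
  \<open>Y\<close> occurs at most once.\<close>

definition ab_exp :: "(cone_var \<Rightarrow>\<^sub>0 nat) \<Rightarrow> exps" where
  "ab_exp m = (int (2 * Poly_Mapping.lookup m Var_X + Poly_Mapping.lookup m Var_Y),
     int (Poly_Mapping.lookup m Var_Y + 2 * Poly_Mapping.lookup m Var_Z), 0, 0)"

fun cone_exp :: "exps \<Rightarrow> cone_var \<Rightarrow>\<^sub>0 nat" where
  "cone_exp (i, j, m, n) = monomial_exp (nat i div 2) (nat i mod 2) (nat j div 2)"

text \<open>As i + j is even, i and j leave the same remainder modulo 2, so one exponent of Y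
  accounts for both.\<close>

lemma ab_exp_cone_exp:
  assumes "0 \<le> i" "0 \<le> j" "even (i + j)"
  shows "ab_exp (cone_exp (i, j, 0, 0)) = (i, j, 0, 0)"
proof -
  obtain p q where ij: "i = int p" "j = int q" using assms nonneg_int_cases by metis
  then have "even (p + q)" using assms by presburger
  then have "2 * (p div 2) + p mod 2 = p" "p mod 2 + 2 * (q div 2) = q"
    by presburger+
  then show ?thesis by (simp add: ab_exp_def ij flip: of_nat_add of_nat_mult)
qed

text \<open>Pairs of Y are traded for X Z. Hence monomials with the same image in a and b already
  agree modulo the relation, so that there are no further relations.\<close>

lemma cone_monomial_normalize: "cone_monomial (cone_exp (ab_exp m)) = cone_monomial m"
proof -
  let ?i = "Poly_Mapping.lookup m Var_X" and ?j = "Poly_Mapping.lookup m Var_Y" and ?k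
      = "Poly_Mapping.lookup m Var_Z"
  have "cone_gen Var_Y ^ ?j = cone_gen Var_Y ^ (2 * (?j div 2) + ?j mod 2)" by simp
  also have "\<dots> = (cone_gen Var_X * cone_gen Var_Z) ^ (?j div 2) * cone_gen Var_Y ^ (?j mod 2)"
    by (simp only: power_add power_mult cone_gen_relation)
  finally have Y: "cone_gen Var_Y ^ ?j =
    cone_gen Var_X ^ (?j div 2) * cone_gen Var_Z ^ (?j div 2) * cone_gen Var_Y ^ (?j mod 2)"
    by (simp only: power_mult_distrib)
  have "nat (int (2 * ?i + ?j)) div 2 = ?i + ?j div 2" "nat (int (2 * ?i + ?j)) mod 2 = ?j mod 2"
    "nat (int (?j + 2 * ?k)) div 2 = ?j div 2 + ?k"
    by (simp_all only: nat_int) presburger+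
  then show ?thesis
    by (simp only: ab_exp_def cone_exp.simps cone_monomial_def lookup_monomial_exp Y power_add mult_ac)
qed

section \<open>The isomorphism between the center and the cone ring\<close>

definition central_monomial :: "(cone_var \<Rightarrow>\<^sub>0 nat) \<Rightarrow> 'k::field double_jordan" where
  "central_monomial m = z_D ^ Poly_Mapping.lookup m Var_X
     * omega_D ^ Poly_Mapping.lookup m Var_Y * theta_D ^ Poly_Mapping.lookup m Var_Z"

lemma rho_central_monomial:
  "rho (central_monomial m :: 'k::field_char_0 double_jordan)
      = mult_op (Poly_Mapping.single (ab_exp m) 1)"
proof -
  have "rho (central_monomial m :: 'k double_jordan) =
      mult_op ((va ^ 2) ^ Poly_Mapping.lookup m Var_X * (va * vb) ^ Poly_Mapping.lookup m Var_Y
        * (vb ^ 2) ^ Poly_Mapping.lookup m Var_Z)"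
    by (simp only: central_monomial_def rho_mult rho_power rho_z rho_omega rho_theta mult_op_power)
      (simp only: mult_op_mult)
  also have "\<dots> = mult_op (Poly_Mapping.single (ab_exp m) 1)"
    by (simp add: va_def vb_def mon_mult mon_power power2_eq_square ab_exp_def)
      (simp add: mon_def mult.commute)
  finally show ?thesis .
qed

interpretation central_monomial: monoid_rep scale_D "central_monomial :: _ \<Rightarrow> 'k::field_char_0 double_jordan"
proof
  show "central_monomial (m + n)
      = central_monomial m * (central_monomial n :: 'k double_jordan)" for m n
    by (rule rho_inject)
      (simp add: rho_mult rho_central_monomial ab_exp_def lookup_add mult_single algebra_simps flip: mult_op_mult)
qed (simp add: central_monomial_def)

lemma rho_alg_ext_central_monomial:
  "rho (D.alg_ext (central_monomial :: _ \<Rightarrow> 'k::field_char_0 double_jordan) p) =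
     (\<Sum>m\<in>Poly_Mapping.keys p. mult_op (Poly_Mapping.single (ab_exp m) (Poly_Mapping.lookup p m)))"
  by (simp add: D.alg_ext_def rho_sum rho_scale rho_central_monomial scalar_def mult_single flip: mult_op_scalar)

lemma alg_ext_central_monomial_in_gen:
  "D.alg_ext (central_monomial :: _ \<Rightarrow> 'k::field_char_0 double_jordan) p \<in> D.gen {z_D, omega_D, theta_D}"
  unfolding D.alg_ext_def central_monomial_def
  by (intro D.gen_sum D.gen_scale D.gen_mult D.gen_power D.gen_base) simp_all

text \<open>Only linear: \<open>cone_exp\<close> is not additive, as the square of Y is normalized
  to X Z. Multiplicativity holds after passing to the quotient.\<close>

definition cone_poly_of :: "'k::field laurent \<Rightarrow> 'k cone_poly" where
  "cone_poly_of w = monoid_algebra.alg_ext (\<lambda>p. Poly_Mapping.single (cone_exp p) 1) w"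

lemma cone_poly_of_single: "cone_poly_of (Poly_Mapping.single p c) = Poly_Mapping.single (cone_exp p) c"
  unfolding cone_poly_of_def monoid_algebra.alg_ext_single by (simp add: scalar_def mult_single)

lemma cone_poly_of_sum: "cone_poly_of (sum f A) = (\<Sum>i\<in>A. cone_poly_of (f i))"
  by (simp add: cone_poly_of_def monoid_algebra.alg_ext_sum)

text \<open>A central element is multiplication by a polynomial in a and b; evaluating at 1 reads
  off this polynomial.\<close>

definition center_to_cone :: "'k::field double_jordan \<Rightarrow> 'k cone_ring" where
  "center_to_cone c = abs_cone_ring (cone_poly_of (app (rho c) 1))"

text \<open>The composite only normalizes monomials, which does not change their classes.
  Surjectivity and the homomorphism laws follow from this.\<close>

lemma center_to_cone_alg_ext:
  "center_to_cone (D.alg_ext (central_monomial :: _ \<Rightarrow> 'k::field_char_0 double_jordan) p) = abs_cone_ring p"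
  by (simp add: center_to_cone_def rho_alg_ext_central_monomial app_sum_left cone_poly_of_sum
      cone_poly_of_single abs_cone_ring_eq cone.alg_ext_sum cone_monomial_normalize)
    (simp add: cone.alg_ext_def)

text \<open>By \<open>center_rho\<close> all exponents satisfy the parity condition under which
  \<open>ab_exp\<close> undoes \<open>cone_exp\<close>; faithfulness then gives equality in the
  double.\<close>

lemma alg_ext_cone_poly_of:
  assumes "c \<in> center"
  shows "D.alg_ext central_monomial (cone_poly_of (app (rho c) 1))
      = (c :: 'k::field_char_0 double_jordan)"
proof (rule rho_inject)
  let ?l = "app (rho c) 1"
  have exp: "ab_exp (cone_exp p) = p" if "p \<in> Poly_Mapping.keys ?l" for p
  proof -
    obtain i j m n where p: "p = (i, j, m, n)" by (cases p)
    show ?thesis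
      using center_rho(2)[OF assms, of i j m n] that ab_exp_cone_exp[of i j] unfolding p by blast
  qed
  have "cone_poly_of ?l
      = (\<Sum>p\<in>Poly_Mapping.keys ?l. Poly_Mapping.single (cone_exp p) (Poly_Mapping.lookup ?l p))"
    by (subst (1) poly_mapping_sum_single[of ?l]) (simp only: cone_poly_of_sum cone_poly_of_single)
  then have "rho (D.alg_ext central_monomial (cone_poly_of ?l)) =
      (\<Sum>p\<in>Poly_Mapping.keys ?l. mult_op (Poly_Mapping.single p (Poly_Mapping.lookup ?l p)))"
    by (simp add: D.alg_ext_sum rho_sum rho_scale rho_central_monomial exp scalar_def mult_single
        flip: mult_op_scalar)
  also have "\<dots> = mult_op ?l"
    by (rule lin_op_eqI) (simp add: app_sum_left flip: sum_distrib_right poly_mapping_sum_single)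
  finally show "rho (D.alg_ext central_monomial (cone_poly_of ?l)) = rho c"
    using center_rho(1)[OF assms] by simp
qed

theorem center_eq_gen:
  "(center :: 'k::field_char_0 double_jordan set) = D.gen {z_D, omega_D, theta_D}"
proof (rule subset_antisym[OF subsetI gen_subset_center])
  fix c :: "'k double_jordan"
  assume "c \<in> center"
  from alg_ext_cone_poly_of[OF this, symmetric] show "c \<in> D.gen {z_D, omega_D, theta_D}"
    by (rule ssubst) (rule alg_ext_central_monomial_in_gen)
qed

theorem algebra_iso_center_to_cone:
  "algebra_iso scale_D (center :: 'k::field_char_0 double_jordan set) scale_cone UNIV center_to_cone"
proof -
  let ?\<Phi> = "D.alg_ext (central_monomial :: _ \<Rightarrow> 'k double_jordan)"
  have in_center: "?\<Phi> p \<in> center" for p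
    using alg_ext_central_monomial_in_gen center_eq_gen by blast
  have ex: "\<exists>p. c = ?\<Phi> p" if "c \<in> center" for c
    by (rule exI) (rule alg_ext_cone_poly_of[OF that, symmetric])
  have "inj_on center_to_cone (center :: 'k double_jordan set)"
  proof (rule inj_onI)
    fix a b :: "'k double_jordan"
    assume ab: "a \<in> center" "b \<in> center" "center_to_cone a = center_to_cone b"
    \<comment> \<open>Evaluation at z, \<omega>, \<theta> respects the relation, so equal classes in
      the cone ring come from equal central elements.\<close>
    have zero: "?\<Phi> p = 0" if "p \<in> cone_rels" for p
    proof -
      have single: "?\<Phi> (poly_var i) = central_monomial (Poly_Mapping.single i 1)" for i
        by (simp add: poly_var_def D.scale_one)
      have "z_D * theta_D = (omega_D ^ 2 :: 'k double_jordan)"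
        by (rule rho_inject) (simp add: rho_mult rho_power rho_z rho_omega rho_theta mult_op_power
            power_mult_distrib flip: mult_op_mult)
      then show ?thesis
        using that by (simp add: cone_rels_def D.alg_ext_diff central_monomial.alg_ext_mult power2_eq_square
            single central_monomial_def lookup_single)
    qed
    have "?\<Phi> (cone_poly_of (app (rho a) 1)) = ?\<Phi> (cone_poly_of (app (rho b) 1))"
      using ab(3) by (intro central_monomial.alg_ext_ideal_cong[of cone_rels] zero)
        (auto simp: center_to_cone_def cone_ring.abs_eq_iff)
    then show "a = b" by (simp only: alg_ext_cone_poly_of[OF ab(1)] alg_ext_cone_poly_of[OF ab(2)])
  qed
  moreover have "center_to_cone ` (center :: 'k double_jordan set) = UNIV"
  proof -
    have "r \<in> center_to_cone ` (center :: 'k double_jordan set)" for r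
    proof -
      have "center_to_cone (?\<Phi> (rep_cone_ring r)) = r"
        by (simp only: center_to_cone_alg_ext Quotient3_abs_rep[OF Quotient3_cone_ring])
      from this[symmetric] show ?thesis by (rule image_eqI) (rule in_center)
    qed
    then show ?thesis by blast
  qed
  ultimately have bij: "bij_betw center_to_cone (center :: 'k double_jordan set) UNIV"
    by (simp add: bij_betw_def)
  have one: "center_to_cone (1 :: 'k double_jordan) = 1"
    using center_to_cone_alg_ext[of "1 :: 'k cone_poly"]
    by (simp add: central_monomial.alg_ext_one one_cone_ring_def)
  \<comment> \<open>The laws are transported from \<open>?\<Phi>\<close>, a homomorphism onto the
    center.\<close>
  have hom: "center_to_cone (a + b) = center_to_cone a + center_to_cone b \<and>
    center_to_cone (a * b) = center_to_cone a * center_to_cone b"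
    if ab: "a \<in> center" "b \<in> center" for a b :: "'k double_jordan"
  proof -
    obtain p where p: "a = ?\<Phi> p" using ex[OF ab(1)] by (elim exE)
    obtain q where q: "b = ?\<Phi> q" using ex[OF ab(2)] by (elim exE)
    show ?thesis
      by (simp only: p q D.alg_ext_add[symmetric] central_monomial.alg_ext_mult[symmetric]
          center_to_cone_alg_ext plus_cone_ring.abs_eq times_cone_ring.abs_eq simp_thms)
  qed
  have scale: "center_to_cone (scale_D k a) = scale_cone k (center_to_cone a)"
    if a: "a \<in> center" for a :: "'k double_jordan" and k
  proof -
    obtain p where p: "a = ?\<Phi> p" using ex[OF a] by (elim exE)
    show ?thesis
      by (simp only: p central_monomial.alg_ext_scalar[symmetric] center_to_cone_alg_ext scale_cone.abs_eq)
  qed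
  show ?thesis
    unfolding algebra_iso_def using bij one hom scale by simp
qed

theorem theorem4p10:
  shows "(center :: 'k::{alg_closed_field, field_char_0} double_jordan set)
           = subalgebra scale_D hull {z_D, omega_D, theta_D}
    \<and> (\<forall>a \<in> subalgebra scale_D hull {z_D, omega_D, theta_D :: 'k double_jordan}.
         \<forall>b \<in> subalgebra scale_D hull {z_D, omega_D, theta_D}. a * b = b * a)
    \<and> (\<exists>f. algebra_iso scale_D (center :: 'k double_jordan set) scale_cone UNIV f)"
proof (intro conjI)
  show "(center :: 'k double_jordan set) = D.gen {z_D, omega_D, theta_D}"
    by (rule center_eq_gen)
  show "\<forall>a \<in> D.gen {z_D, omega_D, theta_D :: 'k double_jordan}.
      \<forall>b \<in> D.gen {z_D, omega_D, theta_D}. a * b = b * a"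
  proof (intro ballI)
    fix a b :: "'k double_jordan"
    assume "a \<in> D.gen {z_D, omega_D, theta_D}"
    then have "a \<in> center" by (rule subsetD[OF gen_subset_center])
    then show "a * b = b * a" unfolding center_def by blast
  qed
  show "\<exists>f. algebra_iso scale_D (center :: 'k double_jordan set) scale_cone UNIV f"
    by (rule exI, rule algebra_iso_center_to_cone)
qed

end
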